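(* Let $A=\langle a_1,a_2\mid \Pi(a_1,a_2,m_A)=\Pi(a_2,a_1,m_A)\rangle$ and $B=\langle b_1,b_2\mid \Pi(b_1,b_2,m_B)=\Pi(b_2,b_1,m_B)\rangle$ be dihedral Artin groups, with $m_A,m_B\in\{2,3,4,\dots\}\cup\{\infty\}$ (no relation when the label is $\infty$), and let $\varphi:A\to B$ be a homomorphism with $\varphi(a_1)=b_1$. Then: (1) If $m_A=\infty$, then $\varphi(a_2)$ can take any value in $B$. (2) If $m_A$ is odd and $m_B$ is even or $\infty$, then $\varphi(a_2)=b_1$. (3) If $m_A$ and $m_B$ are odd, then either $\varphi(a_2)=b_1$, or $m_B$ divides $m_A$ and there exists $t\in\mathbb{Z}$ with $\varphi(a_2)=b_1^t b_2 b_1^{-t}$. (4) If $m_A$ is even and $m_B=\infty$, then there exists $t\in\mathbb{Z}$ with $\varphi(a_2)=b_1^t$. (5) If $m_A$ is even and $m_B$ is odd, then one of the following holds: there exist $t_1,t_2\in\mathbb{Z}$ with $\varphi(a_2)=\delta_B^{t_1}b_1^{t_2}$; or $4$ divides $m_A$ and there exist $\beta\in B$, $t\in\mathbb{Z}$ with $\varphi(a_2)=b_1^{-1}\beta\Delta_B^t\beta^{-1}$; or there exist $\beta\in B$, $t\in\mathbb{Z}$ with $\varphi(a_2)=b_1^{-1}\beta u_B^t\beta^{-1}$ and, setting $p=\gcd(t,m_B)$ and $q=m_B/p$, $q$ divides $m_A/2$. (6) If $m_A$ and $m_B$ are even and $m_B\neq 2$, then one of the following holds: there exist $t_1,t_2\in\mathbb{Z}$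 with $\varphi(a_2)=\delta_B^{t_1}b_1^{t_2}$; or there exist $\beta\in B$, $t\in\mathbb{Z}$ with $\varphi(a_2)=b_1^{-1}\beta u_B^t\beta^{-1}$ and, setting $p=\gcd(t,m_B/2)$ and $q=m_B/(2p)$, $q$ divides $m_A/2$. (7) If $m_A$ is even and $m_B=2$, then $\varphi(a_2)$ can be any element of $B$.
   Context: $\Pi(s,t,m)$ denotes the alternating word $sts\cdots$ of length $m$. For a dihedral Artin group $B=\langle b_1,b_2\mid \Pi(b_1,b_2,m_B)=\Pi(b_2,b_1,m_B)\rangle$ with $m_B$ finite: the Garside element is $\Delta_B=\Pi(b_1,b_2,m_B)=\Pi(b_2,b_1,m_B)$; $\delta_B=\Delta_B^2$ if $m_B$ is odd and $\delta_B=\Delta_B$ if $m_B$ is even (for $m_B\ge3$, $\delta_B$ generates the center of $B$); and $u_B=b_1b_2$. Statements "can take any value" mean that every element of $B$ occurs as $\varphi(a_2)$ for some such homomorphism $\varphi$. *)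

theory Defs
  imports "HOL-Algebra.Group" "HOL-Library.Extended_Nat"
begin

text \<open>Dihedral Artin groups given by generators and relations.
  A letter is a pair (inverted, generator) where generator False means the
  first generator s_1 and True the second generator s_2.  Words are lists of
  letters.  The label is an extended natural (infinity = no relation).\<close>

type_synonym letter = "bool \<times> bool"
type_synonym word = "letter list"

definition gen1 :: letter where "gen1 = (False, False)"
definition gen2 :: letter where "gen2 = (False, True)"

definition alt :: "'a \<Rightarrow> 'a \<Rightarrow> nat \<Rightarrow> 'a list" where
  "alt x y n = map (\<lambda>i. if even i then x else y) [0..<n]"

inductive art_eq :: "enat \<Rightarrow> word \<Rightarrow> word \<Rightarrow> bool" for m where
  refl: "art_eq m w w"
| sym: "art_eq m u v \<Longrightarrow> art_eq m v u"
| trans: "art_eq m u v \<Longrightarrow> art_eq m v w \<Longrightarrow> art_eq m u w"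
| cancel: "art_eq m (u @ [(b, g), (\<not> b, g)] @ v) (u @ v)"
| braid: "m = enat n \<Longrightarrow> art_eq m (u @ alt gen1 gen2 n @ v) (u @ alt gen2 gen1 n @ v)"

definition wcls :: "enat \<Rightarrow> word \<Rightarrow> word set" where
  "wcls m w = {v. art_eq m w v}"

definition Artin :: "enat \<Rightarrow> word set monoid" where
  "Artin m = \<lparr> carrier = range (wcls m),
               mult = (\<lambda>X Y. {w. \<exists>u\<in>X. \<exists>v\<in>Y. art_eq m (u @ v) w}),
               one = wcls m [] \<rparr>"

definition sgen1 :: "enat \<Rightarrow> word set" where "sgen1 m = wcls m [gen1]"
definition sgen2 :: "enat \<Rightarrow> word set" where "sgen2 m = wcls m [gen2]"

definition Garside :: "nat \<Rightarrow> word set" where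
  "Garside n = wcls (enat n) (alt gen1 gen2 n)"

definition central_delta :: "nat \<Rightarrow> word set" where
  "central_delta n = (if odd n then Garside n \<otimes>\<^bsub>Artin (enat n)\<^esub> Garside n else Garside n)"

definition u_elt :: "enat \<Rightarrow> word set" where
  "u_elt m = sgen1 m \<otimes>\<^bsub>Artin m\<^esub> sgen2 m"

end

theory Submission
  imports Defs "HOL-Algebra.Elementary_Groups" "HOL-Algebra.Generated_Groups" "HOL-Algebra.Bij"
    "HOL-Library.Countable_Set"
begin

text \<open>Write \<open>g\<close> for the image of \<open>a\<^sub>1a\<^sub>2\<close>. The relation of \<open>A\<close> makes \<open>b\<^sub>1\<close> commute with a positive
  power of \<open>g\<close>: with \<open>g\<^bsup>m/2\<^esup>\<close> when \<open>m = m\<^sub>A\<close> is even, and with \<open>g\<^sup>m\<close> when it is odd. The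
  group \<open>B\<close> is an amalgam of two abelian groups \<open>P\<close> and \<open>Q\<close> over a central subgroup \<open>Z\<close>: with
  \<open>u = b\<^sub>1b\<^sub>2\<close>, it is \<open>\<langle>u\<rangle> *\<^sub>Z \<langle>\<Delta>\<rangle>\<close> over \<open>Z = \<langle>\<Delta>\<^sup>2\<rangle>\<close> for odd \<open>m\<^sub>B\<close>, and \<open>\<langle>u\<rangle> *\<^sub>Z (\<langle>b\<^sub>1\<rangle> \<times> Z)\<close> over
  \<open>Z = \<langle>u\<^sup>k\<rangle>\<close> for \<open>m\<^sub>B = 2k\<close>, the free group being the case \<open>k = 0\<close>. In such an amalgam the
  centraliser of a nontrivial power of \<open>b\<^sub>1\<close> is \<open>\<langle>b\<^sub>1\<rangle>Z\<close>, and an element with a power in \<open>Z\<close> is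
  conjugate into a factor. So either \<open>g \<in> \<langle>b\<^sub>1\<rangle>Z\<close>, or \<open>g\<close> is conjugate to a power of \<open>u\<close> or of
  \<open>\<Delta>\<close>; the exponents are controlled by homomorphisms from \<open>B\<close> to the integers. When both labels are
  odd, \<open>g\<close> is conjugate to \<open>u\<close>, and the relation of \<open>A\<close> forces the conjugator into \<open>\<langle>b\<^sub>1\<rangle>\<langle>u\<rangle>\<close>.\<close>

section \<open>Groups and alternating products\<close>

lemma (in group) inv_cancel_left [simp]:
  assumes "x \<in> carrier G" "y \<in> carrier G"
  shows "inv x \<otimes> (x \<otimes> y) = y" "x \<otimes> (inv x \<otimes> y) = y"
proof -
  show "inv x \<otimes> (x \<otimes> y) = y" using assms by (simp flip: m_assoc)
  show "x \<otimes> (inv x \<otimes> y) = y" using assms by (simp flip: m_assoc)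
qed

lemma (in group) conj_nat_pow:
  assumes "b \<in> carrier G" "x \<in> carrier G"
  shows "(b \<otimes> x \<otimes> inv b) [^] (n::nat) = b \<otimes> x [^] n \<otimes> inv b"
proof (induction n)
  case 0 show ?case  using assms by simp
next
  case (Suc n)
  have "(b \<otimes> x \<otimes> inv b) [^] Suc n = b \<otimes> x [^] n \<otimes> inv b \<otimes> (b \<otimes> x \<otimes> inv b)"
    by (simp add: Suc)
  then show ?case using assms by (simp add: m_assoc)
qed

lemma (in group) commute_inv:
  assumes "x \<otimes> y = y \<otimes> x" "x \<in> carrier G" "y \<in> carrier G"
  shows "inv x \<otimes> y = y \<otimes> inv x"
proof -
  have "inv x \<otimes> y = inv x \<otimes> (y \<otimes> x) \<otimes> inv x"
    using assms(2,3) by (simp add: m_assoc)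
  also have "\<dots> = inv x \<otimes> (x \<otimes> y) \<otimes> inv x"
    by (simp only: assms(1))
  finally show ?thesis
    using assms(2,3) by (simp add: m_assoc)
qed

lemma (in group) commute_int_pow:
  fixes t :: int
  assumes "x \<otimes> y = y \<otimes> x" "x \<in> carrier G" "y \<in> carrier G"
  shows "x [^] t \<otimes> y = y \<otimes> x [^] t"
proof -
  have *: "x [^] n \<otimes> y = y \<otimes> x [^] n" for n :: nat
    by (rule group_commutes_pow[OF assms])
  have "inv (x [^] n) \<otimes> y = y \<otimes> inv (x [^] n)" for n :: nat
    by (rule commute_inv[OF * nat_pow_closed[OF assms(2)] assms(3)])
  with * show ?thesis
    unfolding int_pow_def2 by presburger
qed

text \<open>The element \<open>\<Pi>(x, y, n)\<close> of \<open>G\<close>; stripping the first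
  letter exchanges the two arguments.\<close>

fun alt_prod :: "('a, 'b) monoid_scheme \<Rightarrow> 'a \<Rightarrow> 'a \<Rightarrow> nat \<Rightarrow> 'a" where
  "alt_prod G x y 0 = \<one>\<^bsub>G\<^esub>"
| "alt_prod G x y (Suc n) = x \<otimes>\<^bsub>G\<^esub> alt_prod G y x n"

lemma (in group) alt_prod_closed [simp]:
  "x \<in> carrier G \<Longrightarrow> y \<in> carrier G \<Longrightarrow> alt_prod G x y n \<in> carrier G"
  by (induction n arbitrary: x y) auto

lemma (in group) alt_prod_even:
  assumes "x \<in> carrier G" "y \<in> carrier G"
  shows "alt_prod G x y (2 * k) = (x \<otimes> y) [^] k"
proof (induction k)
  case (Suc k)
  have "alt_prod G x y (2 * Suc k) = x \<otimes> (y \<otimes> (x \<otimes> y) [^] k)"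
    using Suc by simp
  also have "\<dots> = (x \<otimes> y) [^] Suc k"
    using nat_pow_Suc2[of "x \<otimes> y" k] assms by (simp add: m_assoc)
  finally show ?case .
qed simp

lemma (in group) pow_mult_swap:
  assumes "x \<in> carrier G" "y \<in> carrier G"
  shows "x \<otimes> (y \<otimes> x) [^] (k::nat) = (x \<otimes> y) [^] k \<otimes> x"
proof (induction k)
  case (Suc k)
  have "x \<otimes> (y \<otimes> x) [^] Suc k = (x \<otimes> (y \<otimes> x) [^] k) \<otimes> (y \<otimes> x)"
    using assms by (simp add: m_assoc)
  then show ?case using assms by (simp add: Suc m_assoc)
qed (use assms in simp)

lemma (in group) alt_prod_odd:
  assumes "x \<in> carrier G" "y \<in> carrier G"
  shows "alt_prod G x y (Suc (2 * k)) = (x \<otimes> y) [^] k \<otimes> x"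
  using assms by (simp add: alt_prod_even pow_mult_swap)

lemma hom_alt_prod:
  assumes "\<phi> \<in> hom G H" "group G" "group H" "x \<in> carrier G" "y \<in> carrier G"
  shows "\<phi> (alt_prod G x y n) = alt_prod H (\<phi> x) (\<phi> y) n"
  using assms(4,5)
proof (induction n arbitrary: x y)
  case 0
  then show ?case using assms hom_one by auto
next
  case (Suc n)
  then show ?case
    using assms by (simp add: hom_mult[OF assms(1)] group.alt_prod_closed)
qed

section \<open>Powers of commuting elements, and the Artin relation by parity\<close>

context group
begin

lemma int_pow_commute:
  fixes i j :: int
  assumes "x \<in> carrier G" "y \<in> carrier G" "x \<otimes> y = y \<otimes> x"
  shows "x [^] i \<otimes> y [^] j = y [^] j \<otimes> x [^] i"
proof -
  have "x [^] i \<otimes> y = y \<otimes> x [^] i"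
    using assms by (intro commute_int_pow)
  then show ?thesis
    using assms(1,2) commute_int_pow[of y "x [^] i" j] by simp
qed

lemma two_powers_mult:
  fixes i j k l :: int
  assumes "x \<in> carrier G" "y \<in> carrier G" "x \<otimes> y = y \<otimes> x"
  shows "(x [^] i \<otimes> y [^] j) \<otimes> (x [^] k \<otimes> y [^] l) = x [^] (i + k) \<otimes> y [^] (j + l)"
proof -
  have "(x [^] i \<otimes> y [^] j) \<otimes> (x [^] k \<otimes> y [^] l) = x [^] i \<otimes> (y [^] j \<otimes> x [^] k) \<otimes> y [^] l"
    using assms(1,2) by (simp add: m_assoc)
  also have "\<dots> = x [^] i \<otimes> (x [^] k \<otimes> y [^] j) \<otimes> y [^] l"
    using int_pow_commute[OF assms, of k j] by simp
  also have "\<dots> = x [^] (i + k) \<otimes> y [^] (j + l)"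
    using assms(1,2) by (simp add: m_assoc int_pow_mult)
  finally show ?thesis .
qed

lemma subgroup_two_powers:
  assumes "x \<in> carrier G" "y \<in> carrier G" "x \<otimes> y = y \<otimes> x"
  shows "subgroup {x [^] i \<otimes> y [^] j | (i::int) (j::int). True} G" (is "subgroup ?S G")
proof (rule subgroupI)
  show "?S \<subseteq> carrier G" using assms by auto
  show "?S \<noteq> {}" by blast
next
  fix a assume "a \<in> ?S"
  then obtain i j :: int where a: "a = x [^] i \<otimes> y [^] j" by blast
  have "(x [^] (- i) \<otimes> y [^] (- j)) \<otimes> a = \<one>"
    unfolding a two_powers_mult[OF assms] by simp
  then have "inv a = x [^] (- i) \<otimes> y [^] (- j)"
    using assms a by (intro inv_equality) auto
  then show "inv a \<in> ?S" by blast
next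
  fix a b assume "a \<in> ?S" "b \<in> ?S"
  then show "a \<otimes> b \<in> ?S" using two_powers_mult[OF assms] by blast
qed

lemma subgroup_int_powers:
  assumes "x \<in> carrier G"
  shows "subgroup (range (\<lambda>i::int. x [^] i)) G"
proof -
  have "{x [^] i \<otimes> \<one> [^] j | (i::int) (j::int). True} = range (\<lambda>i::int. x [^] i)"
    using assms by auto
  then show ?thesis using subgroup_two_powers[of x \<one>] assms by simp
qed

text \<open>By \<open>pow_mult_swap\<close>, \<open>(y \<otimes> x) [^] k\<close> is the conjugate
  of \<open>(x \<otimes> y) [^] k\<close> by \<open>inv x\<close>, so the even relation is a
  centraliser condition on \<open>x\<close>.\<close>

lemma even_relation_iff:
  assumes "x \<in> carrier G" "y \<in> carrier G"
  shows "alt_prod G x y (2 * k) = alt_prod G y x (2 * k) \<longleftrightarrow>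
    x \<otimes> (x \<otimes> y) [^] k = (x \<otimes> y) [^] k \<otimes> x"
  unfolding alt_prod_even[OF assms] alt_prod_even[OF assms(2,1)] pow_mult_swap[OF assms, symmetric]
  using assms by simp

lemma odd_relation_iff:
  assumes "x \<in> carrier G" "y \<in> carrier G"
  shows "alt_prod G x y (Suc (2 * k)) = alt_prod G y x (Suc (2 * k)) \<longleftrightarrow>
    (x \<otimes> y) [^] k \<otimes> x = y \<otimes> (x \<otimes> y) [^] k"
  unfolding alt_prod_odd[OF assms] alt_prod_odd[OF assms(2,1)] pow_mult_swap[OF assms(2,1)] ..

text \<open>Rewrite rules for degree maps: exponents are later compared by arithmetic in the
  integers.\<close>

lemma hom_integer_group:
  assumes "\<phi> \<in> hom G integer_group"
  shows "x \<in> carrier G \<Longrightarrow> y \<in> carrier G \<Longrightarrow> \<phi> (x \<otimes> y) = \<phi> x + \<phi> y"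
    and "x \<in> carrier G \<Longrightarrow> \<phi> (inv x) = - \<phi> x"
    and "x \<in> carrier G \<Longrightarrow> \<phi> (x [^] (i::int)) = i * \<phi> x"
    and "x \<in> carrier G \<Longrightarrow> \<phi> (x [^] (n::nat)) = int n * \<phi> x"
proof -
  interpret \<phi>: group_hom G integer_group \<phi>
    using assms by (simp add: group_hom_def group_hom_axioms_def)
  show "x \<in> carrier G \<Longrightarrow> y \<in> carrier G \<Longrightarrow> \<phi> (x \<otimes> y) = \<phi> x + \<phi> y"
    and "x \<in> carrier G \<Longrightarrow> \<phi> (inv x) = - \<phi> x"
    and "x \<in> carrier G \<Longrightarrow> \<phi> (x [^] (i::int)) = i * \<phi> x"
    and "x \<in> carrier G \<Longrightarrow> \<phi> (x [^] (n::nat)) = int n * \<phi> x"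
    by (simp_all add: \<phi>.hom_int_pow \<phi>.hom_nat_pow)
qed

lemma commute_generate:
  assumes "S \<subseteq> carrier G" "z \<in> carrier G" "\<And>s. s \<in> S \<Longrightarrow> z \<otimes> s = s \<otimes> z"
    and "g \<in> generate G S"
  shows "z \<otimes> g = g \<otimes> z"
  using assms(4)
proof (induction rule: generate.induct)
  case (inv h)
  then show ?case using commute_inv[of h z] assms(1-3) by auto
next
  case (eng h1 h2)
  have [simp]: "h1 \<in> carrier G" "h2 \<in> carrier G"
    using eng generate_in_carrier[OF assms(1)] by auto
  have "z \<otimes> (h1 \<otimes> h2) = h1 \<otimes> z \<otimes> h2"
    using eng assms(2) by (simp flip: m_assoc)
  then show ?case using eng assms(2) by (simp add: m_assoc)
qed (use assms(1-3) in auto)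

end

text \<open>\<open>a\<close> commutes with \<open>x \<otimes> a\<close> and hence with its
  \<open>n\<close>-th power, which then cancels from the relation.\<close>

lemma (in group) commute_relation_eq:
  assumes "x \<in> carrier G" "a \<in> carrier G" "x \<otimes> a = a \<otimes> x"
    and "(x \<otimes> a) [^] (n::nat) \<otimes> x = a \<otimes> (x \<otimes> a) [^] n"
  shows "a = x"
proof -
  have "(x \<otimes> a) \<otimes> a = a \<otimes> (x \<otimes> a)"
    using m_assoc[of a x a] assms(1,2) by (simp only: assms(3))
  then have "(x \<otimes> a) [^] n \<otimes> a = a \<otimes> (x \<otimes> a) [^] n"
    using assms(1,2) by (intro group_commutes_pow) simp_all
  then have "(x \<otimes> a) [^] n \<otimes> a = (x \<otimes> a) [^] n \<otimes> x"
    using assms(4) by simp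
  then show ?thesis using assms(1,2) by simp
qed

text \<open>With \<open>g = x \<otimes> a\<close> the relation reads
  \<open>x \<otimes> g [^] n \<otimes> x = g [^] Suc n\<close>. Substituting this at the right or at
  the left end of \<open>x \<otimes> g [^] n \<otimes> x \<otimes> g [^] n \<otimes> x\<close> gives
  the two sides.\<close>

lemma (in group) odd_relation_commute:
  assumes "x \<in> carrier G" "a \<in> carrier G"
    and rel: "(x \<otimes> a) [^] (n::nat) \<otimes> x = a \<otimes> (x \<otimes> a) [^] n"
  shows "x \<otimes> (x \<otimes> a) [^] Suc (2 * n) = (x \<otimes> a) [^] Suc (2 * n) \<otimes> x"
proof -
  define g where "g = x \<otimes> a"
  have g [simp]: "g \<in> carrier G" using assms by (simp add: g_def)
  have gS: "g [^] Suc n \<otimes> g [^] n = g [^] Suc (2 * n)" "g [^] n \<otimes> g [^] Suc n = g [^] Suc (2 * n)"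
    by (simp_all only: nat_pow_mult[OF g]) (simp_all add: mult_2)
  have 1: "x \<otimes> (g [^] n \<otimes> x) = g [^] Suc n"
    using rel assms(1,2) nat_pow_Suc2[of g n] by (simp add: g_def m_assoc)
  have "x \<otimes> g [^] Suc (2 * n) = x \<otimes> (g [^] n \<otimes> (x \<otimes> (g [^] n \<otimes> x)))"
    unfolding 1 gS ..
  also have "\<dots> = (x \<otimes> (g [^] n \<otimes> x)) \<otimes> g [^] n \<otimes> x"
    using assms(1) by (simp add: m_assoc)
  also have "\<dots> = g [^] Suc (2 * n) \<otimes> x"
    unfolding 1 gS ..
  finally show ?thesis by (simp add: g_def)
qed

section \<open>Amalgams of two abelian groups over a central subgroup\<close>

text \<open>\<open>segment G F Z n i j g\<close>: \<open>g\<close> is a product of \<open>n\<close> letters taken alternately from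
  \<open>F True - Z\<close> and \<open>F False - Z\<close>, the first one in \<open>F i\<close> and the last one in \<open>F j\<close>.\<close>

inductive segment ::
  "('a, 'b) monoid_scheme \<Rightarrow> (bool \<Rightarrow> 'a set) \<Rightarrow> 'a set \<Rightarrow> nat \<Rightarrow> bool \<Rightarrow> bool \<Rightarrow> 'a \<Rightarrow> bool"
  for G F Z where
  letter: "x \<in> F i \<Longrightarrow> x \<notin> Z \<Longrightarrow> segment G F Z 1 i i x"
| cons: "x \<in> F i \<Longrightarrow> x \<notin> Z \<Longrightarrow> segment G F Z n (\<not> i) j g \<Longrightarrow>
         segment G F Z (Suc n) i j (x \<otimes>\<^bsub>G\<^esub> g)"

text \<open>Everything about the amalgam except nontriviality of reduced words, which
  \<open>central_amalgam\<close> adds and a ping-pong argument in this locale provides. Indexing by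
  \<open>bool\<close> lets \<open>\<not> i\<close> name the other factor.\<close>

locale central_factors = group G for G (structure) +
  fixes F :: "bool \<Rightarrow> 'a set" and Z :: "'a set"
  assumes factor: "subgroup (F i) G"
    and center: "subgroup Z G"
    and center_le: "Z \<subseteq> F i"
    and central: "z \<in> Z \<Longrightarrow> g \<in> carrier G \<Longrightarrow> z \<otimes> g = g \<otimes> z"
    and factor_comm: "x \<in> F i \<Longrightarrow> y \<in> F i \<Longrightarrow> x \<otimes> y = y \<otimes> x"
    and generated: "carrier G = generate G (F True \<union> F False)"
begin

abbreviation "seg \<equiv> segment G F Z"

text \<open>The length is forgotten: it serves as an induction measure, while the two end factors
  decide what can be concatenated.\<close>

definition "reduced i j g \<longleftrightarrow> (\<exists>n. seg n i j g)"

lemma F_carrier [simp]: "x \<in> F i \<Longrightarrow> x \<in> carrier G"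
  by (rule subgroup.mem_carrier[OF factor])

lemma Z_carrier [simp]: "x \<in> Z \<Longrightarrow> x \<in> carrier G"
  by (rule subgroup.mem_carrier[OF center])

lemma F_mult: "x \<in> F i \<Longrightarrow> y \<in> F i \<Longrightarrow> x \<otimes> y \<in> F i"
  by (rule subgroup.m_closed[OF factor])

lemma Z_mult: "x \<in> Z \<Longrightarrow> y \<in> Z \<Longrightarrow> x \<otimes> y \<in> Z"
  by (rule subgroup.m_closed[OF center])

lemma F_inv: "x \<in> F i \<Longrightarrow> inv x \<in> F i"
  by (rule subgroup.m_inv_closed[OF factor])

lemma Z_inv: "x \<in> Z \<Longrightarrow> inv x \<in> Z"
  by (rule subgroup.m_inv_closed[OF center])

lemma Z_F: "x \<in> Z \<Longrightarrow> x \<in> F i"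
  using center_le by blast

lemma Z_one [simp]: "\<one> \<in> Z"
  by (rule subgroup.one_closed[OF center])

lemma F_one [simp]: "\<one> \<in> F i"
  by (simp add: Z_F)

lemma Z_inv_iff: "x \<in> carrier G \<Longrightarrow> inv x \<in> Z \<longleftrightarrow> x \<in> Z"
  using Z_inv[of x] Z_inv[of "inv x"] by auto

lemma Z_mult_iff1:
  assumes "z \<in> Z" "x \<in> carrier G"
  shows "z \<otimes> x \<in> Z \<longleftrightarrow> x \<in> Z"
  using assms Z_mult[of z x] Z_mult[of "inv z" "z \<otimes> x"] Z_inv[of z] Z_carrier[of z] by auto

lemma Z_conj_iff:
  assumes "b \<in> carrier G" "x \<in> carrier G"
  shows "b \<otimes> x \<otimes> inv b \<in> Z \<longleftrightarrow> x \<in> Z"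
proof -
  have *: "b \<otimes> y \<otimes> inv b = y" if "y \<in> Z" "b \<in> carrier G" for y b
    using that by (simp add: m_assoc flip: central[of y b])
  have "inv b \<otimes> (b \<otimes> x \<otimes> inv b) \<otimes> inv (inv b) = x"
    using assms by (simp add: m_assoc)
  then show ?thesis
    using *[of x b] *[of "b \<otimes> x \<otimes> inv b" "inv b"] assms by auto
qed

section \<open>Calculus of reduced words\<close>

lemma seg_closed [simp]: "seg n i j g \<Longrightarrow> g \<in> carrier G"
  by (induction rule: segment.induct) auto

lemma seg_append:
  "seg n i j g \<Longrightarrow> seg m (\<not> j) l h \<Longrightarrow> seg (n + m) i l (g \<otimes> h)"
proof (induction rule: segment.induct)
  case (letter x i)
  then show ?case using segment.cons[of x F i Z G m l h] by simp
next
  case (cons x i n j g)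
  then show ?case using segment.cons[of x F i Z G "n + m" l "g \<otimes> h"]
    by (simp add: m_assoc)
qed

lemma seg_inv: "seg n i j g \<Longrightarrow> seg n j i (inv g)"
proof (induction rule: segment.induct)
  case (letter x i)
  then show ?case using segment.letter[of "inv x" F i Z G] by (simp add: F_inv Z_inv_iff)
next
  case (cons x i n j g)
  have "seg 1 (\<not> (\<not> i)) i (inv x)"
    using cons segment.letter[of "inv x" F i Z G] by (simp add: F_inv Z_inv_iff)
  from seg_append[OF cons.IH this] cons show ?case
    by (simp add: inv_mult_group)
qed

text \<open>A central factor is absorbed by the first letter, which stays outside
  \<open>Z\<close>.\<close>

lemma seg_central: "seg n i j g \<Longrightarrow> z \<in> Z \<Longrightarrow> seg n i j (z \<otimes> g)"
proof (induction rule: segment.induct)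
  case (letter x i)
  then show ?case using segment.letter[of "z \<otimes> x" F i Z G] by (simp add: Z_F F_mult Z_mult_iff1)
next
  case (cons x i n j g)
  then show ?case using segment.cons[of "z \<otimes> x" F i Z G n j g]
    by (simp add: m_assoc Z_F F_mult Z_mult_iff1)
qed

lemma seg_left:
  assumes "seg n i j g"
  obtains "n = 1" "i = j" "g \<in> F i" "g \<notin> Z"
  | x h m where "n = Suc m" "g = x \<otimes> h" "x \<in> F i" "x \<notin> Z" "seg m (\<not> i) j h"
  using assms by (cases rule: segment.cases) auto

text \<open>\<open>segment\<close> grows on the left only, so the last letter is split off by
  inverting, applying \<open>seg_left\<close> and inverting back.\<close>

lemma seg_right:
  assumes "seg n i j g"
  obtains "n = 1" "i = j" "g \<in> F i" "g \<notin> Z"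
  | x h m where "n = Suc m" "g = h \<otimes> x" "x \<in> F j" "x \<notin> Z" "seg m i (\<not> j) h"
proof (cases rule: seg_left[OF seg_inv[OF assms]])
  case 1
  then show ?thesis using that(1) assms F_inv[of "inv g" j] Z_inv_iff[of g] by auto
next
  case (2 x h m)
  have "g = inv h \<otimes> inv x"
    using 2 assms by (metis F_carrier inv_inv inv_mult_group seg_closed)
  then show ?thesis using that(2)[of m "inv h" "inv x"] 2 seg_inv F_inv Z_inv_iff[of x] by auto
qed

text \<open>\<open>x\<close> merges with the first letter. If the product falls into
  \<open>Z\<close>, the rest of the word absorbs it, so the length cannot grow; the left alternative
  covers words of one letter.\<close>

lemma left_mult:
  assumes "x \<in> F i" "seg n i j g"
  shows "x \<otimes> g \<in> F i \<or> (\<exists>m l. m \<le> n \<and> seg m l j (x \<otimes> g))"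
  using assms(2)
proof (cases rule: seg_left)
  case 1
  then show ?thesis using assms by (simp add: F_mult)
next
  case (2 y h m)
  have eq: "x \<otimes> g = (x \<otimes> y) \<otimes> h"
    using 2 assms by (simp add: m_assoc)
  show ?thesis
  proof (cases "x \<otimes> y \<in> Z")
    case True
    then show ?thesis using eq seg_central[OF 2(5)] 2(1) by (metis le_SucI order_refl)
  next
    case False
    then show ?thesis
      using eq segment.cons[of "x \<otimes> y" F i Z G m j h] 2 assms by (metis F_mult order_refl)
  qed
qed

lemma right_mult:
  assumes "x \<in> F j" "seg n i j g"
  shows "g \<otimes> x \<in> F j \<or> (\<exists>m l. m \<le> n \<and> seg m i l (g \<otimes> x))"
proof -
  have "inv x \<otimes> inv g \<in> F j \<or> (\<exists>m l. m \<le> n \<and> seg m l i (inv x \<otimes> inv g))"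
    using left_mult[of "inv x" j n i "inv g"] assms seg_inv F_inv by simp
  then have "inv (g \<otimes> x) \<in> F j \<or> (\<exists>m l. m \<le> n \<and> seg m l i (inv (g \<otimes> x)))"
    using assms by (simp add: inv_mult_group)
  then show ?thesis using seg_inv F_inv assms
    by (metis F_carrier inv_inv m_closed seg_closed)
qed

lemma reducedI: "x \<in> F i \<Longrightarrow> x \<notin> Z \<Longrightarrow> reduced i i x"
  unfolding reduced_def using segment.letter by fast

lemma reduced_append: "reduced i j g \<Longrightarrow> reduced (\<not> j) l h \<Longrightarrow> reduced i l (g \<otimes> h)"
  unfolding reduced_def using seg_append by blast

lemma reduced_inv: "reduced i j g \<Longrightarrow> reduced j i (inv g)"
  unfolding reduced_def using seg_inv by blast

lemma reduced_closed [simp]: "reduced i j g \<Longrightarrow> g \<in> carrier G"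
  unfolding reduced_def by auto

text \<open>The ends lie in different factors, so consecutive copies of \<open>c\<close> join
  without cancellation.\<close>

lemma reduced_pow:
  assumes "reduced i (\<not> i) c"
  shows "reduced i (\<not> i) (c [^] Suc n)"
proof (induction n)
  case (Suc n)
  then show ?case using reduced_append[OF Suc, of "\<not> i" c] assms by simp
qed (use assms in simp)

lemma left_mult_reduced:
  assumes "x \<in> F i" "g \<in> Z \<or> (\<exists>k j. reduced k j g)"
  shows "x \<otimes> g \<in> Z \<or> (\<exists>k j. reduced k j (x \<otimes> g))"
proof -
  have F: "y \<in> Z \<or> (\<exists>k j. reduced k j y)" if "y \<in> F i" for y i
    using that reducedI by blast
  from assms(2) consider "g \<in> Z" | n k j where "seg n k j g"
    unfolding reduced_def by blast
  then show ?thesis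
  proof cases
    case 1
    then show ?thesis using F[of "x \<otimes> g" i] assms by (simp add: Z_F F_mult)
  next
    case 2
    show ?thesis
    proof (cases "k = i")
      case True
      then show ?thesis using left_mult[OF assms(1), of n j g] 2 F[of "x \<otimes> g" i]
        unfolding reduced_def by blast
    next
      case False
      show ?thesis
      proof (cases "x \<in> Z")
        case True
        then show ?thesis using seg_central[OF 2] reduced_def by blast
      next
        case x: False
        have "k = (\<not> i)" using False by simp
        then show ?thesis using segment.cons[of x F i Z G n j g] x assms(1) 2
          unfolding reduced_def by blast
      qed
    qed
  qed
qed

text \<open>Existence of normal forms, by induction over the generation of \<open>G\<close>.\<close>

lemma reduced_cases:
  assumes "g \<in> carrier G"
  shows "g \<in> Z \<or> (\<exists>i j. reduced i j g)"
proof -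
  \<comment> \<open>A product is handled by moving the letters of \<open>h\<close> onto
    \<open>g\<close> one at a time, the last letter first.\<close>
  have closed: "h \<otimes> g \<in> Z \<or> (\<exists>i j. reduced i j (h \<otimes> g))"
    if "seg n k l h" "g \<in> Z \<or> (\<exists>i j. reduced i j g)" "g \<in> carrier G" for n k l h g
    using that
  proof (induction arbitrary: g rule: segment.induct)
    case (letter x i)
    then show ?case using left_mult_reduced by blast
  next
    case (cons x i n j h)
    have "x \<otimes> (h \<otimes> g) \<in> Z \<or> (\<exists>i j. reduced i j (x \<otimes> (h \<otimes> g)))"
      using left_mult_reduced cons by blast
    then show ?case using cons by (simp add: m_assoc)
  qed
  have F: "y \<in> Z \<or> (\<exists>k j. reduced k j y)" if "y \<in> F i" for y i
    using that reducedI by blast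
  have "g \<in> generate G (F True \<union> F False)"
    using assms generated by simp
  then show ?thesis
  proof (induction rule: generate.induct)
    case one
    then show ?case by simp
  next
    case (incl h)
    then show ?case using F by blast
  next
    case (inv h)
    then show ?case using F F_inv by blast
  next
    case (eng h1 h2)
    have 2: "h2 \<in> carrier G" using eng generated by simp
    from eng(3) consider "h1 \<in> Z" | n k j where "seg n k j h1"
      unfolding reduced_def by blast
    then show ?case
    proof cases
      case 1
      then show ?thesis using left_mult_reduced[of h1 True h2] eng Z_F by simp
    next
      case 2
      then show ?thesis using closed eng \<open>h2 \<in> carrier G\<close> by blast
    qed
  qed
qed

end

text \<open>\<open>seg_notin\<close> is the weak form of the normal form theorem; it makes
  \<open>G\<close> the amalgamated product of the two factors over \<open>Z\<close>.\<close>

locale central_amalgam = central_factors +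
  assumes seg_notin: "segment G F Z n i j g \<Longrightarrow> g \<notin> Z"
begin

lemma reduced_notin: "reduced i j g \<Longrightarrow> g \<notin> Z"
  unfolding reduced_def using seg_notin by blast

lemma not_reduced_one: "\<not> reduced i j \<one>"
  using reduced_notin Z_one by blast

text \<open>If both ends lie in the same factor, conjugation moves the first letter to the end,
  where it merges with the last one and gives a shorter word.\<close>

lemma cyclic_reduction:
  "seg n i j g \<Longrightarrow> \<exists>b\<in>carrier G. \<exists>c\<in>carrier G. g = b \<otimes> c \<otimes> inv b \<and>
     ((\<exists>i. c \<in> F i) \<or> (\<exists>i. reduced i (\<not> i) c))"
proof (induction n arbitrary: i j g rule: less_induct)
  case (less n)
  have triv: ?case if "(\<exists>i. g \<in> F i) \<or> (\<exists>i. reduced i (\<not> i) g)"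
    using that less.prems by (intro bexI[of _ \<one>] bexI[of _ g]) auto
  show ?case
  proof (cases "i = j")
    case False
    then have "j = (\<not> i)" by simp
    then have "reduced i (\<not> i) g"
      using less.prems reduced_def by blast
    then show ?thesis using triv by blast
  next
    case True
    from less.prems show ?thesis
    proof (cases rule: seg_left)
      case 1
      then show ?thesis using triv by blast
    next
      case (2 x h m)
      have g: "g = x \<otimes> (h \<otimes> x) \<otimes> inv x"
        using 2 seg_closed[OF 2(5)] by (simp add: m_assoc)
      consider "h \<otimes> x \<in> F i" | m' l where "m' \<le> m" "seg m' (\<not> i) l (h \<otimes> x)"
        using right_mult[of x j m "\<not> i" h] 2 True by blast
      then show ?thesis
      proof cases
        case 1
        then show ?thesis using g 2 by (intro bexI[of _ x] bexI[of _ "h \<otimes> x"]) auto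
      next
        case shorter: 2
        from less.IH[OF _ this(2)] this(1) 2(1) obtain b c where
          b: "b \<in> carrier G" "c \<in> carrier G" "h \<otimes> x = b \<otimes> c \<otimes> inv b"
          and c: "(\<exists>i. c \<in> F i) \<or> (\<exists>i. reduced i (\<not> i) c)" by auto
        have "g = (x \<otimes> b) \<otimes> c \<otimes> inv (x \<otimes> b)"
          using g 2 b by (simp add: m_assoc inv_mult_group)
        then show ?thesis
          using b c 2 by (intro bexI[of _ "x \<otimes> b"] bexI[of _ c]) auto
      qed
    qed
  qed
qed

text \<open>Modulo \<open>Z\<close> this says that torsion in a free product is conjugate into a
  factor: a cyclically reduced \<open>c\<close> with ends in different factors has reduced powers,
  which avoid \<open>Z\<close>.\<close>

lemma torsion_conj_factor:
  assumes g: "g \<in> carrier G" and k: "k > 0" "g [^] (k::nat) \<in> Z"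
  obtains b c i where "b \<in> carrier G" "c \<in> F i" "g = b \<otimes> c \<otimes> inv b" "c [^] k \<in> Z"
proof (cases "g \<in> Z")
  case True
  then show ?thesis using that[of \<one> g True] assms Z_F by simp
next
  case False
  then obtain n i j where "seg n i j g"
    using reduced_cases[OF g] reduced_def by blast
  from cyclic_reduction[OF this] obtain b c where
    b: "b \<in> carrier G" "c \<in> carrier G" "g = b \<otimes> c \<otimes> inv b"
    and c: "(\<exists>i. c \<in> F i) \<or> (\<exists>i. reduced i (\<not> i) c)" by auto
  have ck: "c [^] k \<in> Z"
    using k b by (simp add: conj_nat_pow Z_conj_iff)
  have "\<not> reduced i (\<not> i) c" for i
    using reduced_pow[of i c "k - 1"] ck k(1) reduced_notin by auto
  then show ?thesis using that b c ck by blast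
qed

text \<open>Stripping from \<open>g\<close> the letters of \<open>F i\<close> at both ends leaves a
  word \<open>v\<close> with both ends in the other factor. The stripped letters commute with
  \<open>c\<close>, so \<open>v\<close> does too; but the commutator of \<open>v\<close> and
  \<open>c\<close> is a reduced word.\<close>

lemma factor_centralizer:
  assumes c: "c \<in> F i" "c \<notin> Z" and g: "g \<in> carrier G" and comm: "g \<otimes> c = c \<otimes> g"
  shows "g \<in> F i"
proof (rule ccontr)
  assume not: "g \<notin> F i"
  then obtain n l j where g': "seg n l j g"
    using reduced_cases[OF g] reduced_def Z_F by blast
  \<comment> \<open>\<open>a\<close>, and likewise \<open>b\<close> below, is \<open>\<one>\<close>
    when that end of the word already lies in the other factor.\<close>
  obtain a h m where a: "a \<in> F i" "g = a \<otimes> h" and h: "seg m (\<not> i) j h"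
  proof (cases "l = i")
    case True
    from g' show ?thesis
      by (cases rule: seg_left) (use True not that in auto)
  next
    case False
    then have "l = (\<not> i)" by simp
    then show ?thesis using that[of \<one> g n] g' by simp
  qed
  obtain b v m' where b: "b \<in> F i" "h = v \<otimes> b" and v: "seg m' (\<not> i) (\<not> i) v"
  proof (cases "j = i")
    case True
    from h show ?thesis
      by (cases rule: seg_right) (use True that in auto)
  next
    case False
    then have "j = (\<not> i)" by simp
    then show ?thesis using that[of \<one> h m] h by simp
  qed
  have [simp]: "v \<in> carrier G" using v by simp
  have "a \<otimes> (v \<otimes> c) \<otimes> b = a \<otimes> (c \<otimes> v) \<otimes> b"
  proof -
    have "a \<otimes> (v \<otimes> c) \<otimes> b = a \<otimes> v \<otimes> (b \<otimes> c)"
      using a b c factor_comm[of b i c] by (simp add: m_assoc)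
    also have "\<dots> = c \<otimes> (a \<otimes> v \<otimes> b)"
      using comm a b c by (simp add: m_assoc)
    also have "\<dots> = (a \<otimes> c) \<otimes> v \<otimes> b"
      using a b c factor_comm[of a i c] by (simp add: m_assoc)
    finally show ?thesis using a b c by (simp add: m_assoc)
  qed
  then have "v \<otimes> c = c \<otimes> v"
    using a b c by simp
  then have "(v \<otimes> c) \<otimes> (inv v \<otimes> inv c) = \<one>"
    using c by (simp add: m_assoc)
  moreover have "reduced (\<not> i) i ((v \<otimes> c) \<otimes> (inv v \<otimes> inv c))"
  proof -
    have v': "reduced (\<not> i) (\<not> i) v" using v reduced_def by blast
    have "reduced (\<not> i) i (v \<otimes> c)"
      using reduced_append[OF v'] reducedI[OF c] by simp
    moreover have "reduced (\<not> i) i (inv v \<otimes> inv c)"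
      using reduced_append[OF reduced_inv[OF v']] reducedI[of "inv c" i] c by (simp add: F_inv Z_inv_iff)
    ultimately show ?thesis using reduced_append by blast
  qed
  ultimately show False using not_reduced_one by simp
qed

end

text \<open>The shape of the odd case: \<open>d = \<Delta>\<close>, \<open>s\<close> is a power of \<open>u\<close>, and \<open>b\<^sub>1\<close> is \<open>s \<otimes> d\<close>.\<close>

locale half_amalgam = central_amalgam +
  fixes s d :: 'a
  assumes s: "s \<in> F True" "s \<notin> Z"
    and d: "d \<in> F False" "d \<notin> Z"
    and index_two: "x \<in> F False \<Longrightarrow> x \<notin> Z \<Longrightarrow> inv d \<otimes> x \<in> Z"
begin

abbreviation "c \<equiv> s \<otimes> d"

lemma s_carrier [simp]: "s \<in> carrier G" and d_carrier [simp]: "d \<in> carrier G"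
  using s d by simp_all

lemma index_two':
  assumes "x \<in> F False" "x \<notin> Z"
  shows "d \<otimes> x \<in> Z"
proof -
  have "inv (d \<otimes> x) = inv d \<otimes> inv x"
    using assms d by (simp add: inv_mult_group factor_comm[of "inv x" False "inv d"] F_inv)
  moreover have "inv d \<otimes> inv x \<in> Z"
    using index_two[of "inv x"] assms by (simp add: F_inv Z_inv_iff)
  ultimately show ?thesis
    using assms Z_inv_iff[of "d \<otimes> x"] by simp
qed

lemma reduced_c: "reduced True False c"
  using reduced_append[of True True s False d] s d by (simp add: reducedI)

text \<open>As \<open>d\<close> is its own inverse modulo \<open>Z\<close>, a reduced word starting in \<open>F False\<close> starts like
  \<open>inv c\<close>, and one starting with \<open>s\<close> starts like \<open>c\<close>.\<close>

lemma shorten: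
  assumes "seg n i j g"
  obtains e where "e \<in> {1, - 1 :: int}" "c [^] e \<otimes> g \<in> F True"
  | e m l where "e \<in> {1, - 1 :: int}" "m < n" "seg m l j (c [^] e \<otimes> g)"
  | "g \<in> F True"
  | p h where "g = p \<otimes> h" "p \<in> F True" "p \<notin> Z" "inv s \<otimes> p \<notin> Z" "reduced False j h"
proof (cases i)
  case False
  from assms show ?thesis
  proof (cases rule: seg_left)
    case 1
    have "c [^] (1::int) \<otimes> g = s \<otimes> (d \<otimes> g)"
      using 1 by (simp add: m_assoc)
    moreover have "d \<otimes> g \<in> F True"
      using index_two'[of g] 1 False by (simp add: Z_F)
    ultimately show ?thesis
      using that(1)[of 1] s F_mult by simp
  next
    case (2 x h m)
    \<comment> \<open>The letter \<open>x\<close> cancels against \<open>d\<close> up to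
      \<open>Z\<close>, and what remains merges with \<open>s\<close> into an element of
      \<open>F True\<close>.\<close>
    have "c [^] (1::int) \<otimes> g = (s \<otimes> (d \<otimes> x)) \<otimes> h"
      using 2 seg_closed[OF 2(5)] by (simp add: m_assoc)
    moreover have "s \<otimes> (d \<otimes> x) \<in> F True"
      using index_two'[of x] 2 s False by (simp add: Z_F F_mult)
    ultimately have "c [^] (1::int) \<otimes> g \<in> F True \<or>
        (\<exists>m' l. m' \<le> m \<and> seg m' l j (c [^] (1::int) \<otimes> g))"
      using left_mult[of "s \<otimes> (d \<otimes> x)" True m j h] 2 False by simp
    then show ?thesis
      using that(1,2) 2(1) by (metis insertI1 less_Suc_eq_le)
  qed
next
  case True
  from assms show ?thesis
  proof (cases rule: seg_left)
    case 1
    then show ?thesis using that(3) True by simp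
  next
    case (2 p h m)
    show ?thesis
    proof (cases "inv s \<otimes> p \<in> Z")
      case False
      then show ?thesis using that(4)[of p h] 2 True reduced_def by auto
    next
      case z: True
      have p: "p \<in> F True" and [simp]: "h \<in> carrier G" using 2 True by simp_all
      \<comment> \<open>\<open>p\<close> equals \<open>s\<close> up to \<open>Z\<close>, so
        \<open>inv c\<close> removes it; the remaining \<open>inv d\<close> then cancels up to
        \<open>Z\<close> against the first letter of \<open>h\<close>.\<close>
      have "c [^] (- 1::int) \<otimes> g = inv d \<otimes> ((inv s \<otimes> p) \<otimes> h)"
        using 2 by (simp add: int_pow_neg inv_mult_group m_assoc)
      also have "\<dots> = (inv s \<otimes> p) \<otimes> (inv d \<otimes> h)"
        using 2 central[OF z, of "inv d"] by (simp flip: m_assoc)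
      finally have eq: "c [^] (- 1::int) \<otimes> g = (inv s \<otimes> p) \<otimes> (inv d \<otimes> h)" .
      from 2(5) show ?thesis
      proof (cases rule: seg_left)
        case 1
        then have "inv d \<otimes> h \<in> Z" using index_two True by simp
        then show ?thesis using that(1)[of "- 1"] eq z by (simp add: Z_F Z_mult)
      next
        case (2 x h' m')
        have [simp]: "h' \<in> carrier G" using 2 by simp
        have "inv d \<otimes> x \<in> Z" using 2 index_two True by simp
        then have "seg m' True j ((inv s \<otimes> p) \<otimes> (inv d \<otimes> x) \<otimes> h')"
          using seg_central[OF _ Z_mult[OF z]] 2 True by simp
        moreover have "(inv s \<otimes> p) \<otimes> (inv d \<otimes> x) \<otimes> h' = c [^] (- 1::int) \<otimes> g"
          using eq 2 p by (simp add: m_assoc)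
        ultimately show ?thesis
          using that(2)[of "- 1" m' True] 2(1) \<open>n = Suc m\<close> by simp
      qed
    qed
  qed
qed

text \<open>Isolates the leading \<open>s\<close>, so that a letter of \<open>F True\<close> placed
  before the power can merge with it.\<close>

lemma c_pow_Suc:
  obtains r where "reduced False False r" "c [^] Suc k = s \<otimes> r"
proof
  show "c [^] Suc k = s \<otimes> (d \<otimes> c [^] k)"
    using nat_pow_Suc2[of c k] by (simp add: m_assoc)
  show "reduced False False (d \<otimes> c [^] k)"
    using reduced_append[of False False d False "c [^] k"] reducedI[of d False] d
      reduced_pow[of True c] reduced_c by (cases k) auto
qed

text \<open>For \<open>p\<close> outside \<open>Z\<close>, the commutator
  \<open>inv p \<otimes> C \<otimes> p \<otimes> inv C\<close> is \<open>inv p \<otimes> s\<close>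
  times a reduced word \<open>w\<close> starting in \<open>F False\<close>; it is nontrivial whether
  or not \<open>inv p \<otimes> s\<close> lies in \<open>Z\<close>.\<close>

lemma factor_commute_c_pow:
  assumes p: "p \<in> F True" and comm: "p \<otimes> c [^] Suc k = c [^] Suc k \<otimes> p"
  shows "p \<in> Z"
proof (rule ccontr)
  assume "p \<notin> Z"
  define C where "C = c [^] Suc k"
  obtain r where r: "reduced False False r" and ck: "C = s \<otimes> r"
    using c_pow_Suc unfolding C_def by metis
  have [simp]: "r \<in> carrier G" "p \<in> carrier G" "C \<in> carrier G"
    using r p C_def by simp_all
  define w where "w = r \<otimes> p \<otimes> inv C"
  have w: "reduced False True w"
    unfolding w_def C_def
    using reduced_append[OF reduced_append[OF r] reduced_inv[OF reduced_pow]] reduced_c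
      reducedI[OF p \<open>p \<notin> Z\<close>] by simp
  have "(inv p \<otimes> s) \<otimes> w = inv p \<otimes> (C \<otimes> p) \<otimes> inv C"
    unfolding w_def using ck by (simp add: m_assoc)
  also have "\<dots> = \<one>"
    unfolding comm[folded C_def, symmetric] by (simp add: m_assoc)
  finally have eq: "(inv p \<otimes> s) \<otimes> w = \<one>" .
  show False
  proof (cases "inv p \<otimes> s \<in> Z")
    case True
    then show False
      using Z_mult_iff1[OF True, of w] eq w reduced_notin by simp
  next
    case False
    then have "reduced True True ((inv p \<otimes> s) \<otimes> w)"
      using reduced_append[of True True "inv p \<otimes> s" True w] w reducedI p s
      by (simp add: F_mult F_inv)
    then show False using eq not_reduced_one by simp
  qed
qed

lemma c_int_pow_commute:
  fixes e :: int
  shows "c [^] e \<otimes> c [^] (k::nat) = c [^] k \<otimes> c [^] e"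
  by (simp add: add.commute flip: int_pow_mult int_pow_int)

lemma c_int_pow_cancel:
  fixes e :: int
  assumes "g \<in> carrier G"
  shows "g = c [^] (- e) \<otimes> (c [^] e \<otimes> g)"
  using assms by (simp add: int_pow_neg)

text \<open>Multiplying \<open>g\<close> on the left by powers of \<open>c\<close> preserves
  hypothesis and conclusion, so \<open>shorten\<close> gives an induction on length. A word it
  cannot shorten lies in \<open>F True\<close>, where \<open>factor_commute_c_pow\<close> applies,
  or has a reduced commutator with \<open>C\<close>.\<close>

lemma c_pow_centralizer:
  assumes "g \<in> carrier G" "g \<otimes> c [^] Suc k = c [^] Suc k \<otimes> g"
  shows "\<exists>t::int. \<exists>z\<in>Z. g = z \<otimes> c [^] t"
proof -
  define C where "C = c [^] Suc k"
  obtain r where r: "reduced False False r" and ck: "C = s \<otimes> r"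
    using c_pow_Suc unfolding C_def by metis
  have [simp]: "r \<in> carrier G" "C \<in> carrier G"
    using r C_def by simp_all
  have C: "reduced True False C"
    unfolding C_def using reduced_pow[of True c] reduced_c by simp
  have F: "p \<in> Z" if "p \<in> F True" "p \<otimes> C = C \<otimes> p" for p
    using factor_commute_c_pow[of p k] that unfolding C_def by simp
  have shift: "c [^] e \<otimes> g \<otimes> C = C \<otimes> (c [^] e \<otimes> g)"
    if g: "g \<in> carrier G" "g \<otimes> C = C \<otimes> g" for g and e :: int
  proof -
    have "c [^] e \<otimes> g \<otimes> C = c [^] e \<otimes> C \<otimes> g"
      using g by (simp add: m_assoc)
    also have "\<dots> = C \<otimes> c [^] e \<otimes> g"
      unfolding C_def c_int_pow_commute ..
    finally show ?thesis using g by (simp add: m_assoc)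
  qed
  have "\<exists>t::int. \<exists>z\<in>Z. g = z \<otimes> c [^] t" if "seg n i j g" "g \<otimes> C = C \<otimes> g" for n i j g
    using that
  proof (induction n arbitrary: i j g rule: less_induct)
    case (less n)
    have g: "g \<in> carrier G" using less.prems by simp
    have unshift: ?case if "c [^] e \<otimes> g = z \<otimes> c [^] t" "z \<in> Z" for z and e t :: int
    proof -
      have "g = c [^] (- e) \<otimes> (z \<otimes> c [^] t)"
        using c_int_pow_cancel[OF g, of e] that by simp
      also have "\<dots> = z \<otimes> (c [^] (- e) \<otimes> c [^] t)"
        using that central[of z "c [^] (- e)"] by (simp flip: m_assoc)
      finally show ?thesis using that by (auto simp flip: int_pow_mult)
    qed
    from less.prems(1) show ?case
    proof (cases rule: shorten)
      case (1 e)
      then have "c [^] e \<otimes> g \<in> Z"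
        using F shift less.prems g by blast
      then show ?thesis using unshift[of e _ 0] g by simp
    next
      case (2 e m l)
      then show ?thesis using less.IH[OF 2(2,3)] shift less.prems(2) g unshift by blast
    next
      case 3
      then have "g \<in> Z" using F less.prems by blast
      then show ?thesis using g by (intro exI[of _ 0] bexI[of _ g]) auto
    next
      case (4 p h)
      have [simp]: "h \<in> carrier G" "p \<in> carrier G" using 4 by simp_all
      have p: "reduced True True p" "reduced True True (inv p)"
        "reduced True True (inv p \<otimes> s)" "reduced True True (inv s \<otimes> p)"
        using 4 s reducedI Z_inv_iff[of "inv s \<otimes> p"] by (auto simp: F_mult F_inv Z_inv_iff inv_mult_group)
      have h: "reduced j False (inv h)"
        using 4 reduced_inv by simp
      \<comment> \<open>The last letter of \<open>h\<close> must meet a letter of the other factor.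
        As \<open>inv C\<close> starts in \<open>F False\<close> and \<open>C\<close> in
        \<open>F True\<close>, the end factor \<open>j\<close> decides which commutator is
        expanded.\<close>
      show ?thesis
      proof (cases j)
        case True
        have "reduced j True (inv h \<otimes> (inv p \<otimes> s))"
          using reduced_append[OF h] p by simp
        from reduced_append[OF this, of False r] r have "reduced j False (inv h \<otimes> (inv p \<otimes> s) \<otimes> r)"
          by simp
        from reduced_append[OF this, of True p] p
        have "reduced j True (inv h \<otimes> (inv p \<otimes> s) \<otimes> r \<otimes> p)" by simp
        from reduced_append[OF this, of j h] 4
        have "reduced j j (inv h \<otimes> (inv p \<otimes> s) \<otimes> r \<otimes> p \<otimes> h)" by simp
        from reduced_append[OF this, of True "inv C"] reduced_inv[OF C] True
        have "reduced j True (inv h \<otimes> (inv p \<otimes> s) \<otimes> r \<otimes> p \<otimes> h \<otimes> inv C)" by simp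
        also have "inv h \<otimes> (inv p \<otimes> s) \<otimes> r \<otimes> p \<otimes> h \<otimes> inv C = inv g \<otimes> (C \<otimes> g) \<otimes> inv C"
          using 4(1) ck by (simp add: m_assoc inv_mult_group)
        also have "\<dots> = \<one>"
          using g by (simp add: m_assoc flip: less.prems(2))
        finally show ?thesis using not_reduced_one by blast
      next
        case False
        have "reduced j True (inv h \<otimes> inv p)"
          using reduced_append[OF h] p by simp
        from reduced_append[OF this, of False "inv r"] reduced_inv[OF r]
        have "reduced j False (inv h \<otimes> inv p \<otimes> inv r)" by simp
        from reduced_append[OF this, of True "inv s \<otimes> p"] p
        have "reduced j True (inv h \<otimes> inv p \<otimes> inv r \<otimes> (inv s \<otimes> p))" by simp
        from reduced_append[OF this, of j h] 4
        have "reduced j j (inv h \<otimes> inv p \<otimes> inv r \<otimes> (inv s \<otimes> p) \<otimes> h)" by simp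
        from reduced_append[OF this, of False C] C False
        have "reduced j False (inv h \<otimes> inv p \<otimes> inv r \<otimes> (inv s \<otimes> p) \<otimes> h \<otimes> C)" by simp
        also have "inv h \<otimes> inv p \<otimes> inv r \<otimes> (inv s \<otimes> p) \<otimes> h \<otimes> C = inv g \<otimes> inv C \<otimes> (g \<otimes> C)"
          using 4(1) ck by (simp add: m_assoc inv_mult_group)
        also have "\<dots> = \<one>"
          using g by (simp add: m_assoc less.prems(2))
        finally show ?thesis using not_reduced_one by blast
      qed
    qed
  qed
  moreover have "g = g \<otimes> c [^] (0::int)" using assms by simp
  ultimately show ?thesis
    using reduced_cases[OF assms(1)] assms(2) unfolding reduced_def C_def by metis
qed

text \<open>A conjugator that cannot be shortened on the left by powers of \<open>c\<close> or on the right by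
  \<open>F True\<close> would make the element being squared cyclically reduced.\<close>

lemma c_conj_square:
  assumes "b \<in> carrier G"
    and "(inv s \<otimes> (inv b \<otimes> c \<otimes> b)) \<otimes> (inv s \<otimes> (inv b \<otimes> c \<otimes> b)) \<in> Z"
  shows "\<exists>t::int. \<exists>p\<in>F True. b = c [^] t \<otimes> p"
proof -
  define E where "E b = inv s \<otimes> (inv b \<otimes> c \<otimes> b)" for b
  have E_closed [simp]: "E b \<in> carrier G" if "b \<in> carrier G" for b
    using that by (simp add: E_def)
  \<comment> \<open>Powers of \<open>c\<close> commute with \<open>c\<close>, so they can be removed
    from the left of \<open>b\<close>.\<close>
  have E_shift: "E (c [^] e \<otimes> b) = E b" if "b \<in> carrier G" for b and e :: int
  proof -
    have "inv (c [^] e \<otimes> b) \<otimes> c \<otimes> (c [^] e \<otimes> b) = inv b \<otimes> inv (c [^] e) \<otimes> (c [^] (1::nat) \<otimes> c [^] e) \<otimes> b"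
      using that by (simp add: inv_mult_group m_assoc)
    also have "\<dots> = inv b \<otimes> inv (c [^] e) \<otimes> (c [^] e \<otimes> c [^] (1::nat)) \<otimes> b"
      unfolding c_int_pow_commute ..
    also have "\<dots> = inv b \<otimes> c \<otimes> b"
      using that by (simp add: m_assoc)
    finally show ?thesis by (simp add: E_def)
  qed
  have F: "\<exists>t::int. \<exists>p\<in>F True. b = c [^] t \<otimes> p" if "b \<in> F True" for b
    using that by (intro exI[of _ 0] bexI[of _ b]) auto
  have "\<exists>t::int. \<exists>p\<in>F True. b = c [^] t \<otimes> p" if "seg n i j b" "E b \<otimes> E b \<in> Z" for n i j b
    using that
  proof (induction n arbitrary: i j b rule: less_induct)
    case (less n)
    have b: "b \<in> carrier G" using less.prems by simp
    show ?case
    proof (cases j)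
      case True
      from less.prems(1) show ?thesis
      proof (cases rule: seg_right)
        case 1
        then show ?thesis using F True by simp
      next
        case (2 p h m)
        have [simp]: "h \<in> carrier G" "p \<in> carrier G" using 2 by simp_all
        \<comment> \<open>\<open>p\<close> commutes with \<open>s\<close>, so a right factor of
          \<open>b\<close> from \<open>F True\<close> merely conjugates \<open>E\<close>, and
          membership of its square in \<open>Z\<close> is unaffected.\<close>
        have "E b = inv p \<otimes> E h \<otimes> inv (inv p)"
          using 2 True s factor_comm[of "inv s" True "inv p"]
          by (simp add: E_def inv_mult_group F_inv flip: m_assoc)
        then have "E b \<otimes> E b = inv p \<otimes> (E h \<otimes> E h) \<otimes> inv (inv p)"
          by (simp add: m_assoc)
        then have "E h \<otimes> E h \<in> Z"
          using less.prems(2) Z_conj_iff[of "inv p" "E h \<otimes> E h"] by simp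
        then obtain t :: int and p' where "p' \<in> F True" "h = c [^] t \<otimes> p'"
          using less.IH[of m i "\<not> j" h] 2 by auto
        then have "b = c [^] t \<otimes> (p' \<otimes> p)" "p' \<otimes> p \<in> F True"
          using 2 True by (simp_all add: m_assoc F_mult)
        then show ?thesis by blast
      qed
    next
      case False
      from less.prems(1) show ?thesis
      proof (cases rule: shorten)
        case (1 e)
        then show ?thesis using c_int_pow_cancel[OF b, of e] by blast
      next
        case (2 e m l)
        then obtain t :: int and p where p: "p \<in> F True" "c [^] e \<otimes> b = c [^] t \<otimes> p"
          using less.IH[OF 2(2,3)] E_shift[OF b] less.prems(2) by auto
        have "b = c [^] (- e) \<otimes> (c [^] t \<otimes> p)"
          using c_int_pow_cancel[OF b, of e] p by simp
        also have "\<dots> = c [^] (- e + t) \<otimes> p"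
          using p int_pow_mult[of c "- e" t] by (simp add: m_assoc)
        finally show ?thesis using p by blast
      next
        case 3
        then show ?thesis using F by blast
      next
        case (4 p h)
        have [simp]: "h \<in> carrier G" "p \<in> carrier G" using 4 by simp_all
        have p: "reduced True True p" "reduced True True (inv p \<otimes> s)" "reduced True True (inv s)"
          using 4 s reducedI Z_inv_iff[of "inv s \<otimes> p"] by (auto simp: F_mult F_inv Z_inv_iff inv_mult_group)
        have h: "reduced False False (inv h)" "reduced False False h"
          using 4 reduced_inv False by simp_all
        have "reduced True False (inv s \<otimes> inv h)"
          using reduced_append[of True True "inv s"] p h by simp
        from reduced_append[OF this, of True "inv p \<otimes> s"] p
        have "reduced True True (inv s \<otimes> inv h \<otimes> (inv p \<otimes> s))" by simp
        from reduced_append[OF this, of False d] d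
        have "reduced True False (inv s \<otimes> inv h \<otimes> (inv p \<otimes> s) \<otimes> d)" by (simp add: reducedI)
        from reduced_append[OF this, of True p] p
        have "reduced True True (inv s \<otimes> inv h \<otimes> (inv p \<otimes> s) \<otimes> d \<otimes> p)" by simp
        from reduced_append[OF this, of False h] h
        have "reduced True False (inv s \<otimes> inv h \<otimes> (inv p \<otimes> s) \<otimes> d \<otimes> p \<otimes> h)" by simp
        also have "inv s \<otimes> inv h \<otimes> (inv p \<otimes> s) \<otimes> d \<otimes> p \<otimes> h = E b"
          using 4(1) by (simp add: E_def m_assoc inv_mult_group)
        finally have "reduced True False (E b)" .
        \<comment> \<open>The ends lie in different factors, so squaring causes no
          cancellation.\<close>
        then have "reduced True False (E b \<otimes> E b)"
          using reduced_append[of True False "E b"] by simp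
        then show ?thesis using less.prems(2) reduced_notin by blast
      qed
    qed
  qed
  then show ?thesis
    using reduced_cases[OF assms(1)] assms(2) F Z_F unfolding reduced_def E_def by metis
qed

end

section \<open>The presentation of a dihedral Artin group\<close>

fun word_eval :: "('a, 'b) monoid_scheme \<Rightarrow> 'a \<Rightarrow> 'a \<Rightarrow> word \<Rightarrow> 'a" where
  "word_eval G x y [] = \<one>\<^bsub>G\<^esub>"
| "word_eval G x y ((b, g) # w) =
    (let e = (if g then y else x) in if b then inv\<^bsub>G\<^esub> e else e) \<otimes>\<^bsub>G\<^esub> word_eval G x y w"

lemma alt_0 [simp]: "alt x y 0 = []"
  by (simp add: alt_def)

lemma alt_Suc [simp]: "alt x y (Suc n) = x # alt y x n"
  by (simp add: alt_def upt_conv_Cons map_Suc_upt[symmetric] del: upt_Suc)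

context group
begin

lemma word_eval_closed [simp]:
  "x \<in> carrier G \<Longrightarrow> y \<in> carrier G \<Longrightarrow> word_eval G x y w \<in> carrier G"
  by (induction w) (auto simp: Let_def split_paired_all)

lemma word_eval_append:
  assumes "x \<in> carrier G" "y \<in> carrier G"
  shows "word_eval G x y (v @ w) = word_eval G x y v \<otimes> word_eval G x y w"
  using assms by (induction v) (auto simp: Let_def m_assoc split_paired_all)

lemma word_eval_alt:
  assumes "x \<in> carrier G" "y \<in> carrier G"
  shows "word_eval G x y (alt gen1 gen2 n) = alt_prod G x y n"
    and "word_eval G x y (alt gen2 gen1 n) = alt_prod G y x n"
  using assms by (induction n) (auto simp: gen1_def gen2_def)

lemma word_eval_art_eq:
  assumes "x \<in> carrier G" "y \<in> carrier G"
    and "\<And>n. m = enat n \<Longrightarrow> alt_prod G x y n = alt_prod G y x n"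
    and "art_eq m v w"
  shows "word_eval G x y v = word_eval G x y w"
  using assms(4)
proof (induction rule: art_eq.induct)
  case (cancel u b g v)
  then show ?case using assms(1,2) by (auto simp: word_eval_append Let_def)
next
  case (braid n u v)
  then show ?case using assms(1-3) by (simp add: word_eval_append word_eval_alt)
qed auto

end

section \<open>The group structure on classes of words\<close>

lemma art_eq_context: "art_eq m u v \<Longrightarrow> art_eq m (x @ u @ y) (x @ v @ y)"
proof (induction rule: art_eq.induct)
  case (cancel u b g v)
  then show ?case using art_eq.cancel[of m "x @ u" b g "v @ y"] by simp
next
  case (braid n u v)
  then show ?case using art_eq.braid[of m n "x @ u" "v @ y"] by simp
next
  case (trans u v w)
  then show ?case using art_eq.trans by blast
qed (simp_all add: art_eq.refl art_eq.sym)

lemma wcls_eq_iff: "wcls m u = wcls m v \<longleftrightarrow> art_eq m u v"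
proof
  assume "wcls m u = wcls m v"
  then have "v \<in> wcls m u" by (simp add: wcls_def art_eq.refl)
  then show "art_eq m u v" by (simp add: wcls_def)
next
  assume uv: "art_eq m u v"
  have "art_eq m u w \<longleftrightarrow> art_eq m v w" for w
    using art_eq.trans[OF uv] art_eq.trans[OF art_eq.sym[OF uv]] by blast
  then show "wcls m u = wcls m v" by (simp add: wcls_def)
qed

lemma Artin_carrier: "carrier (Artin m) = range (wcls m)"
  and Artin_one: "\<one>\<^bsub>Artin m\<^esub> = wcls m []"
  by (simp_all add: Artin_def)

lemma wcls_carrier [simp]: "wcls m w \<in> carrier (Artin m)"
  by (simp add: Artin_carrier)

lemma Artin_mult: "wcls m u \<otimes>\<^bsub>Artin m\<^esub> wcls m v = wcls m (u @ v)"
proof -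
  have "art_eq m (u @ v) (u' @ v')" if "art_eq m u u'" "art_eq m v v'" for u' v'
    using art_eq_context[OF that(1), of "[]" v] art_eq_context[OF that(2), of u' "[]"]
      art_eq.trans by auto
  then have "(\<exists>u'\<in>wcls m u. \<exists>v'\<in>wcls m v. art_eq m (u' @ v') w) \<longleftrightarrow> art_eq m (u @ v) w" for w
    using art_eq.trans[of m "u @ v" _ w] art_eq.refl[of m u] art_eq.refl[of m v]
    unfolding wcls_def by blast
  then show ?thesis
    by (simp add: Artin_def wcls_def)
qed

lemma art_eq_inverse: "art_eq m (rev (map (apfst Not) w) @ w) []"
proof (induction w)
  case Nil
  then show ?case by (simp add: art_eq.refl)
next
  case (Cons a w)
  obtain b g where a: "a = (b, g)" by (cases a)
  have "art_eq m (rev (map (apfst Not) (a # w)) @ (a # w)) (rev (map (apfst Not) w) @ w)"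
    using art_eq.cancel[of m "rev (map (apfst Not) w)" "\<not> b" g w] a by simp
  then show ?case using Cons art_eq.trans by blast
qed

lemma group_Artin: "group (Artin m)"
proof (rule groupI)
  fix x y assume "x \<in> carrier (Artin m)" "y \<in> carrier (Artin m)"
  then show "x \<otimes>\<^bsub>Artin m\<^esub> y \<in> carrier (Artin m)"
    by (auto simp: Artin_carrier Artin_mult)
next
  fix x assume "x \<in> carrier (Artin m)"
  then obtain w where x: "x = wcls m w" by (auto simp: Artin_carrier)
  have "wcls m (rev (map (apfst Not) w)) \<otimes>\<^bsub>Artin m\<^esub> x = \<one>\<^bsub>Artin m\<^esub>"
    unfolding x Artin_one Artin_mult wcls_eq_iff by (rule art_eq_inverse)
  then show "\<exists>y\<in>carrier (Artin m). y \<otimes>\<^bsub>Artin m\<^esub> x = \<one>\<^bsub>Artin m\<^esub>"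
    using wcls_carrier by blast
qed (auto simp: Artin_carrier Artin_mult Artin_one)

lemma sgen_carrier [simp]: "sgen1 m \<in> carrier (Artin m)" "sgen2 m \<in> carrier (Artin m)"
  by (simp_all add: sgen1_def sgen2_def)

lemma wcls_word_eval: "wcls m w = word_eval (Artin m) (sgen1 m) (sgen2 m) w"
proof (induction w)
  case Nil
  then show ?case by (simp add: Artin_one)
next
  case (Cons a w)
  interpret group "Artin m" by (rule group_Artin)
  obtain b g where a: "a = (b, g)" by (cases a)
  have gen: "wcls m [(False, g)] = (if g then sgen2 m else sgen1 m)" for g
    by (simp add: sgen1_def sgen2_def gen1_def gen2_def)
  have inv: "wcls m [(True, g)] = inv\<^bsub>Artin m\<^esub> (wcls m [(False, g)])"
    using art_eq.cancel[of m "[]" True g "[]"]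
    by (intro inv_equality[symmetric]) (auto simp: Artin_mult Artin_one wcls_eq_iff)
  have "wcls m (a # w) = wcls m [a] \<otimes>\<^bsub>Artin m\<^esub> wcls m w"
    by (simp add: Artin_mult)
  then show ?case
    using Cons a inv gen[of g] by (cases b) simp_all
qed

lemma Artin_generated: "carrier (Artin m) = generate (Artin m) {sgen1 m, sgen2 m}"
proof
  interpret group "Artin m" by (rule group_Artin)
  show "generate (Artin m) {sgen1 m, sgen2 m} \<subseteq> carrier (Artin m)"
    by (rule generate_incl) simp
  have "word_eval (Artin m) (sgen1 m) (sgen2 m) w \<in> generate (Artin m) {sgen1 m, sgen2 m}" for w
    by (induction w) (auto simp: Let_def split_paired_all intro: generate.intros)
  then show "carrier (Artin m) \<subseteq> generate (Artin m) {sgen1 m, sgen2 m}"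
    by (auto simp: Artin_carrier wcls_word_eval)
qed

lemma Garside_alt_prod: "Garside n = alt_prod (Artin (enat n)) (sgen1 (enat n)) (sgen2 (enat n)) n"
  unfolding Garside_def wcls_word_eval by (simp add: group.word_eval_alt group_Artin)

lemma Artin_relation:
  assumes "m = enat n"
  shows "alt_prod (Artin m) (sgen1 m) (sgen2 m) n = alt_prod (Artin m) (sgen2 m) (sgen1 m) n"
proof -
  have "wcls m (alt gen1 gen2 n) = wcls m (alt gen2 gen1 n)"
    unfolding wcls_eq_iff using art_eq.braid[OF assms, of "[]" "[]"] by simp
  then show ?thesis
    unfolding wcls_word_eval by (simp add: group.word_eval_alt group_Artin)
qed

text \<open>Von Dyck's theorem: evaluation of words in \<open>H\<close> respects
  \<open>art_eq\<close>.\<close>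

lemma Artin_universal:
  assumes "group H" "x \<in> carrier H" "y \<in> carrier H"
    and rel: "\<And>n. m = enat n \<Longrightarrow> alt_prod H x y n = alt_prod H y x n"
  obtains \<phi> where "\<phi> \<in> hom (Artin m) H" "\<phi> (sgen1 m) = x" "\<phi> (sgen2 m) = y"
proof -
  interpret H: group H by fact
  \<comment> \<open>The representative picked by \<open>SOME\<close> does not matter, since
    evaluation is constant on classes.\<close>
  define \<phi> where "\<phi> X = word_eval H x y (SOME w. w \<in> X)" for X
  have \<phi>: "\<phi> (wcls m w) = word_eval H x y w" for w
  proof -
    have "(SOME v. v \<in> wcls m w) \<in> wcls m w"
      by (rule someI[of _ w]) (simp add: wcls_def art_eq.refl)
    then show ?thesis
      unfolding \<phi>_def using H.word_eval_art_eq[OF assms(2,3) rel]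
      by (metis mem_Collect_eq wcls_def)
  qed
  have "\<phi> \<in> hom (Artin m) H"
    by (rule homI) (auto simp: Artin_carrier Artin_mult \<phi> H.word_eval_append assms)
  moreover have "\<phi> (sgen1 m) = x" "\<phi> (sgen2 m) = y"
    by (simp_all add: sgen1_def sgen2_def gen1_def gen2_def \<phi> assms)
  ultimately show thesis using that by blast
qed

text \<open>The two sides of an odd relation differ by one in the number of each generator, which
  forces equal degrees; the sides of an even relation have the same letter counts.\<close>

lemma Artin_degree:
  assumes "\<And>n. m = enat n \<Longrightarrow> i = j \<or> even n"
  obtains \<phi> :: "word set \<Rightarrow> int" where
    "\<phi> \<in> hom (Artin m) integer_group" "\<phi> (sgen1 m) = i" "\<phi> (sgen2 m) = j"
proof (rule Artin_universal[OF group_integer_group, of i j m])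
  fix n assume "m = enat n"
  then consider "i = j" | k where "n = 2 * k" using assms by (auto elim: evenE)
  then show "alt_prod integer_group i j n = alt_prod integer_group j i n"
    by cases (simp_all add: group.alt_prod_even add.commute)
qed (use that in auto)

section \<open>Ping-pong on the integers\<close>

text \<open>An action of the cyclic group of order \<open>p\<close>, infinite for
  \<open>p = 0\<close>. The integers are identified with \<open>{..0} \<times> R\<close> for the set
  \<open>R\<close> of residues, so that \<open>(y, 0)\<close> corresponds to \<open>y\<close>, and
  the group translates the second coordinate.\<close>

lemma cyclic_int_action:
  fixes p :: nat
  assumes "p \<noteq> 1"
  shows "\<exists>f :: int \<Rightarrow> int \<Rightarrow> int. (\<forall>i j x. f i (f j x) = f (i + j) x) \<and>
    (\<forall>i x. int p dvd i \<longrightarrow> f i x = x) \<and> (\<forall>i x. \<not> int p dvd i \<longrightarrow> x \<le> 0 \<longrightarrow> f i x > 0)"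
proof -
  \<comment> \<open>Since \<open>i mod 0 = i\<close>, \<open>R\<close> consists of all integers when
    \<open>p = 0\<close>.\<close>
  define R where "R = range (\<lambda>i. i mod int p)"
  \<comment> \<open>These pairs are to be matched with the positive integers;
    \<open>p \<noteq> 1\<close> provides a nonzero residue, so there are infinitely many of
    them.\<close>
  define D where "D = {..0::int} \<times> (R - {0})"
  have R: "r mod int p = r" if "r \<in> R" for r
    using that unfolding R_def by auto
  have "1 mod int p \<noteq> 0"
    using assms by (cases "p = 0") auto
  then have "1 mod int p \<in> R - {0}"
    unfolding R_def by blast
  then have "infinite D"
    unfolding D_def using infinite_Iic by (auto simp: finite_cartesian_product_iff)
  moreover have "infinite {0::int<..}"
    by (rule infinite_Ioi)
  ultimately obtain a b where "bij_betw a (UNIV :: nat set) D" "bij_betw b (UNIV :: nat set) {0::int<..}"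
    by (meson countableI_type countable_infiniteE')
  then have e: "bij_betw (b \<circ> inv_into UNIV a) D {0<..}"
    using bij_betw_inv_into bij_betw_trans by blast
  define h where "h = (\<lambda>(y, r). if r = 0 then y else (b \<circ> inv_into UNIV a) (y, r))"
  have "bij_betw h ({..0} \<times> {0} \<union> D) ({..0} \<union> {0<..})"
  proof (rule bij_betw_combine)
    show "bij_betw h ({..0} \<times> {0}) {..0}"
      by (rule bij_betwI[of _ _ _ "\<lambda>y. (y, 0)"]) (auto simp: h_def)
    show "bij_betw h D {0<..}"
      by (rule bij_betw_cong[THEN iffD1, OF _ e]) (auto simp: h_def D_def split: if_splits)
  qed auto
  moreover have "{..0} \<times> {0} \<union> D = {..0} \<times> R"
    using R_def by (auto simp: D_def intro: rev_image_eqI[of 0])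
  moreover have "{..0} \<union> {0<..} = (UNIV :: int set)" by auto
  ultimately have h: "bij_betw h ({..0} \<times> R) UNIV" by simp
  define g where "g = inv_into ({..0} \<times> R) h"
  define f where "f i x = h (fst (g x), (snd (g x) + i) mod int p)" for i x
  have g_in: "g x \<in> {..0} \<times> R" for x
    unfolding g_def using h by (metis UNIV_I bij_betw_def inv_into_into)
  have hg: "h (g x) = x" for x
    unfolding g_def using h by (metis UNIV_I bij_betw_inv_into_right)
  have gh: "g (h z) = z" if "z \<in> {..0} \<times> R" for z
    unfolding g_def using h that by (metis bij_betw_inv_into_left)
  have mod: "i mod int p \<in> R" for i unfolding R_def by auto
  have gf: "g (f i x) = (fst (g x), (snd (g x) + i) mod int p)" for i x
    unfolding f_def using g_in[of x] mod by (intro gh) auto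
  show ?thesis
  proof (intro exI[of _ f] conjI allI impI)
    fix i j x
    have "f i (f j x) = h (fst (g x), ((snd (g x) + j) mod int p + i) mod int p)"
      unfolding f_def[of i] gf by simp
    also have "((snd (g x) + j) mod int p + i) mod int p = (snd (g x) + (i + j)) mod int p"
      by (simp add: mod_add_left_eq mod_add_right_eq algebra_simps)
    finally show "f i (f j x) = f (i + j) x" by (simp add: f_def)
  next
    fix i x assume "int p dvd i"
    then have "(snd (g x) + i) mod int p = snd (g x) mod int p"
      by (metis add.right_neutral dvd_imp_mod_0 mod_add_right_eq)
    also have "\<dots> = snd (g x)" using g_in[of x] R by auto
    finally show "f i x = x" unfolding f_def using hg by simp
  next
    fix i x :: int assume i: "\<not> int p dvd i" "x \<le> 0"
    have "h (x, 0) = x" by (simp add: h_def)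
    moreover have "(x, 0) \<in> {..0} \<times> R" using i mod[of 0] by simp
    ultimately have "g x = (x, 0)" using gh by metis
    then have "f i x = h (x, i mod int p)" by (simp add: f_def)
    moreover have "(x, i mod int p) \<in> D"
      using i mod by (auto simp: D_def dvd_eq_mod_eq_0)
    ultimately show "f i x > 0"
      using e bij_betwE[OF e] by (force simp: h_def D_def)
  qed
qed

section \<open>Permutations of the integers and the ping-pong criterion\<close>

abbreviation "IntPerm \<equiv> BijGroup (UNIV :: int set)"

lemma IntPerm_carrier: "f \<in> carrier IntPerm \<longleftrightarrow> bij f"
  by (simp add: BijGroup_def Bij_def)

lemma IntPerm_mult:
  "f \<in> carrier IntPerm \<Longrightarrow> g \<in> carrier IntPerm \<Longrightarrow> f \<otimes>\<^bsub>IntPerm\<^esub> g = f \<circ> g"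
  by (simp add: BijGroup_def compose_def fun_eq_iff)

lemma IntPerm_one: "\<one>\<^bsub>IntPerm\<^esub> = id"
  by (simp add: BijGroup_def fun_eq_iff)

lemma IntPerm_int_pow:
  assumes add: "\<And>i j x. f i (f j x) = f (i + j) x" and zero: "\<And>x. f 0 x = x"
  shows "f 1 \<in> carrier IntPerm" "f 1 [^]\<^bsub>IntPerm\<^esub> (i :: int) = f i"
proof -
  have bij: "f i \<in> carrier IntPerm" for i
    unfolding IntPerm_carrier by (rule o_bij[of "f (- i)"]) (auto simp: add zero fun_eq_iff)
  then have hom: "f \<in> hom integer_group IntPerm"
    by (intro homI) (auto simp: IntPerm_mult add fun_eq_iff)
  show "f 1 \<in> carrier IntPerm" by (rule bij)
  show "f 1 [^]\<^bsub>IntPerm\<^esub> i = f i"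
    using hom_int_pow[OF hom, of 1 i] group_BijGroup[of "UNIV :: int set"] by simp
qed

text \<open>The two factors of a free product of cyclic groups act on the integers so that nontrivial
  elements of the first one send \<open>{..0}\<close> into \<open>{0<..}\<close> and those of the second one send \<open>{0..}\<close>
  into \<open>{..<0}\<close>; tracking the image of 0 then shows that reduced words act nontrivially.\<close>

lemma ping_pong_perms:
  fixes p q :: nat
  assumes "p \<noteq> 1" "q \<noteq> 1"
  obtains \<sigma> \<tau> where "\<sigma> \<in> carrier IntPerm" "\<tau> \<in> carrier IntPerm"
    "\<And>i. int p dvd i \<Longrightarrow> \<sigma> [^]\<^bsub>IntPerm\<^esub> i = \<one>\<^bsub>IntPerm\<^esub>"
    "\<And>i. int q dvd i \<Longrightarrow> \<tau> [^]\<^bsub>IntPerm\<^esub> i = \<one>\<^bsub>IntPerm\<^esub>"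
    "\<And>i x. \<not> int p dvd i \<Longrightarrow> x \<le> 0 \<Longrightarrow> (\<sigma> [^]\<^bsub>IntPerm\<^esub> i) x > 0"
    "\<And>i x. \<not> int q dvd i \<Longrightarrow> x \<ge> 0 \<Longrightarrow> (\<tau> [^]\<^bsub>IntPerm\<^esub> i) x < 0"
proof -
  from cyclic_int_action[OF assms(1)]
  obtain f :: "int \<Rightarrow> int \<Rightarrow> int" where f: "\<forall>i j x. f i (f j x) = f (i + j) x"
    "\<forall>i x. int p dvd i \<longrightarrow> f i x = x" "\<forall>i x. \<not> int p dvd i \<longrightarrow> x \<le> 0 \<longrightarrow> f i x > 0"
    by (elim exE conjE)
  from cyclic_int_action[OF assms(2)]
  obtain g :: "int \<Rightarrow> int \<Rightarrow> int" where g: "\<forall>i j x. g i (g j x) = g (i + j) x"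
    "\<forall>i x. int q dvd i \<longrightarrow> g i x = x" "\<forall>i x. \<not> int q dvd i \<longrightarrow> x \<le> 0 \<longrightarrow> g i x > 0"
    by (elim exE conjE)
  \<comment> \<open>Conjugation by negation exchanges the roles of the positive and the negative
    integers.\<close>
  define g' where "g' i x = - g i (- x)" for i x
  have f_pow: "f 1 \<in> carrier IntPerm" "f 1 [^]\<^bsub>IntPerm\<^esub> i = f i" for i :: int
    using IntPerm_int_pow[of f] f by auto
  have g_pow: "g' 1 \<in> carrier IntPerm" "g' 1 [^]\<^bsub>IntPerm\<^esub> i = g' i" for i :: int
    using IntPerm_int_pow[of g'] g by (auto simp: g'_def)
  show thesis
  proof (rule that[of "f 1" "g' 1"], unfold f_pow(2) g_pow(2))
    show "f 1 \<in> carrier IntPerm" "g' 1 \<in> carrier IntPerm"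
      by (fact f_pow(1) g_pow(1))+
  qed (auto simp: IntPerm_one g'_def fun_eq_iff f(2,3) g(2,3))
qed

lemma (in central_factors) ping_pong:
  assumes \<rho>: "\<rho> \<in> hom G IntPerm"
    and Z: "\<And>z. z \<in> Z \<Longrightarrow> \<rho> z = \<one>\<^bsub>IntPerm\<^esub>"
    and T: "\<And>x v. x \<in> F True \<Longrightarrow> x \<notin> Z \<Longrightarrow> v \<le> 0 \<Longrightarrow> \<rho> x v > 0"
    and F: "\<And>x v. x \<in> F False \<Longrightarrow> x \<notin> Z \<Longrightarrow> v \<ge> 0 \<Longrightarrow> \<rho> x v < 0"
  shows "central_amalgam G F Z"
proof
  fix n i j g assume "seg n i j g"
  \<comment> \<open>The sign of the image of 0 records the first letter, which acts last; elements
    of \<open>Z\<close> fix 0.\<close>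
  then have "if i then \<rho> g 0 > 0 else \<rho> g 0 < 0"
  proof (induction rule: segment.induct)
    case (letter x i)
    then show ?case using T[of x 0] F[of x 0] by (cases i) auto
  next
    case (cons x i n j g)
    have "\<rho> (x \<otimes> g) = \<rho> x \<circ> \<rho> g"
      using cons hom_mult[OF \<rho>, of x g] hom_in_carrier[OF \<rho>] by (simp add: IntPerm_mult)
    then show ?case using cons T[of x "\<rho> g 0"] F[of x "\<rho> g 0"] by (cases i) auto
  qed
  then show "g \<notin> Z" using Z[of g] by (auto simp: IntPerm_one split: if_splits)
qed

section \<open>Dihedral Artin groups with even or infinite label\<close>

locale artin_group = group G for G :: "word set monoid" (structure) +
  fixes m :: enat
  assumes G: "G = Artin m"
begin

abbreviation "x \<equiv> sgen1 m"
abbreviation "y \<equiv> sgen2 m"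
abbreviation "u \<equiv> x \<otimes> y"

lemma gens_carrier [simp]: "x \<in> carrier G" "y \<in> carrier G"
  using sgen_carrier G by auto

lemma y_eq: "y = inv x \<otimes> u"
  by simp

lemma generate_eqI:
  assumes "x \<in> generate G S" "u \<in> generate G S" "S \<subseteq> carrier G"
  shows "carrier G = generate G S"
proof
  have "y \<in> generate G S"
    using assms generate_is_subgroup[OF assms(3)] subgroup.m_closed subgroup.m_inv_closed y_eq
    by metis
  then have "generate G {x, y} \<subseteq> generate G S"
    using generate_subgroup_incl[OF _ generate_is_subgroup[OF assms(3)]] assms by simp
  then show "carrier G \<subseteq> generate G S"
    using Artin_generated G by simp
  show "generate G S \<subseteq> carrier G" by (rule generate_incl[OF assms(3)])
qed

lemma centralI:
  assumes "z \<in> carrier G" "z \<otimes> x = x \<otimes> z" "z \<otimes> u = u \<otimes> z" "g \<in> carrier G"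
  shows "z \<otimes> g = g \<otimes> z"
proof -
  have "carrier G = generate G {x, u}"
    by (rule generate_eqI) (auto intro: generate.incl)
  then show ?thesis
    using commute_generate[of "{x, u}" z g] assms by (metis empty_subsetI insert_iff insert_subset
      singletonD gens_carrier m_closed)
qed

end

text \<open>\<open>k = 0\<close> stands for the infinite label and \<open>k > 1\<close> for the
  label \<open>2 * k\<close>; label 2, where the group is abelian, is excluded.\<close>

locale even_artin = artin_group +
  fixes k :: nat
  assumes k: "k \<noteq> 1" and m: "m = (if k = 0 then \<infinity> else enat (2 * k))"
begin

text \<open>For a finite label this is \<open>\<Delta> = \<delta>\<close>; for \<open>k = 0\<close>
  it is \<open>\<one>\<close>, so that the free group fits the same description.\<close>

abbreviation "w \<equiv> u [^] int k"

definition "factors b = (if b then range (\<lambda>i::int. u [^] i)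
  else {x [^] i \<otimes> w [^] j | (i::int) (j::int). True})"

definition "centre = range (\<lambda>j::int. w [^] j)"

lemma mem_factors:
  "a \<in> factors True \<longleftrightarrow> (\<exists>i::int. a = u [^] i)"
  "a \<in> factors False \<longleftrightarrow> (\<exists>(i::int) (j::int). a = x [^] i \<otimes> w [^] j)"
  by (simp_all add: factors_def image_iff)

lemma mem_centre: "a \<in> centre \<longleftrightarrow> (\<exists>j::int. a = w [^] j)"
  by (simp add: centre_def image_iff)

lemma factor_TrueE:
  assumes "a \<in> factors True"
  obtains i :: int where "a = u [^] i"
  using assms unfolding mem_factors ..

lemma factor_FalseE:
  assumes "a \<in> factors False"
  obtains i j :: int where "a = x [^] i \<otimes> w [^] j"
  using assms unfolding mem_factors by (elim exE)

lemma centreE: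
  assumes "a \<in> centre"
  obtains j :: int where "a = w [^] j"
  using assms unfolding mem_centre ..

lemma xw: "x \<otimes> w = w \<otimes> x"
proof (cases "k = 0")
  case False
  then have "alt_prod G x y (2 * k) = alt_prod G y x (2 * k)"
    using Artin_relation[of m "2 * k"] m G by simp
  then show ?thesis
    using even_relation_iff[of x y k] by (simp add: int_pow_int)
qed simp

lemma x_factor: "x \<in> factors False"
  unfolding mem_factors by (intro exI[of _ 1] exI[of _ 0]) simp

lemma u_factor: "u \<in> factors True"
  unfolding mem_factors by (intro exI[of _ 1]) simp

lemma uw: "u \<otimes> w = w \<otimes> u"
  by (rule commute_int_pow[symmetric]) simp_all

lemma central_factors: "central_factors G factors centre"
proof (intro central_factors.intro central_factors_axioms.intro)
  show "Group.group G" ..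
  show "subgroup (factors i) G" for i
    using subgroup_int_powers[of u] subgroup_two_powers[of x w] xw
    by (cases i) (simp_all add: factors_def)
  show "subgroup centre G"
    unfolding centre_def by (rule subgroup_int_powers) simp
  show "centre \<subseteq> factors i" for i
  proof (cases i)
    case True
    then show ?thesis using mem_factors mem_centre by (auto simp: int_pow_pow)
  next
    case False
    have "w [^] j \<in> factors False" for j :: int
      unfolding mem_factors by (intro exI[of _ 0] exI[of _ j]) simp
    then show ?thesis using False by (auto simp: centre_def)
  qed
  show "z \<otimes> g = g \<otimes> z" if z: "z \<in> centre" and g: "g \<in> carrier G" for z g
  proof -
    obtain j :: int where z: "z = w [^] j" using z unfolding mem_centre ..
    have "z \<otimes> x = x \<otimes> z" "z \<otimes> u = u \<otimes> z"
      unfolding z using commute_int_pow[of w x j] commute_int_pow[of w u j] xw uw by simp_all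
    then show ?thesis using centralI g z by simp
  qed
  show "a \<otimes> b = b \<otimes> a" if "a \<in> factors i" "b \<in> factors i" for a b i
  proof (cases i)
    case True
    with that have "a \<in> factors True" "b \<in> factors True" by simp_all
    then show ?thesis
      by (elim factor_TrueE) (simp add: add.commute flip: int_pow_mult)
  next
    case False
    with that have "a \<in> factors False" "b \<in> factors False" by simp_all
    then show ?thesis
      by (elim factor_FalseE) (simp add: two_powers_mult xw add.commute)
  qed
  show "carrier G = generate G (factors True \<union> factors False)"
  proof (rule generate_eqI)
    have "x \<in> factors False" "u \<in> factors True"
      by (auto simp: x_factor u_factor)
    then show "x \<in> generate G (factors True \<union> factors False)"
      "u \<in> generate G (factors True \<union> factors False)"
      by (auto intro: generate.incl)
    show "factors True \<union> factors False \<subseteq> carrier G"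
      by (auto simp: factors_def)
  qed
qed

sublocale central_factors G factors centre
  by (rule central_factors)

text \<open>The action sends \<open>u\<close> to \<open>\<sigma>\<close>, of order \<open>k\<close>
  (infinite for \<open>k = 0\<close>), and \<open>x\<close> to \<open>\<tau>\<close>, of infinite
  order. It respects the relation and kills the centre because the \<open>k\<close>-th power of
  \<open>\<sigma>\<close> is trivial.\<close>

sublocale central_amalgam G factors centre
proof -
  interpret S: group IntPerm by (rule group_BijGroup)
  obtain \<sigma> \<tau> where \<sigma>: "\<sigma> \<in> carrier IntPerm" and \<tau>: "\<tau> \<in> carrier IntPerm"
    and \<sigma>1: "\<And>i. int k dvd i \<Longrightarrow> \<sigma> [^]\<^bsub>IntPerm\<^esub> i = \<one>\<^bsub>IntPerm\<^esub>"
    and \<sigma>2: "\<And>i v. \<not> int k dvd i \<Longrightarrow> v \<le> 0 \<Longrightarrow> (\<sigma> [^]\<^bsub>IntPerm\<^esub> i) v > 0"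
    and \<tau>2: "\<And>i v. \<not> int 0 dvd i \<Longrightarrow> v \<ge> 0 \<Longrightarrow> (\<tau> [^]\<^bsub>IntPerm\<^esub> i) v < 0"
    using ping_pong_perms[OF k, of 0] by (metis zero_neq_one)
  define \<tau>' where "\<tau>' = inv\<^bsub>IntPerm\<^esub> \<tau> \<otimes>\<^bsub>IntPerm\<^esub> \<sigma>"
  have [simp]: "\<tau>' \<in> carrier IntPerm" "\<tau> \<otimes>\<^bsub>IntPerm\<^esub> \<tau>' = \<sigma>"
    using \<sigma> \<tau> by (simp_all add: \<tau>'_def)
  have "alt_prod IntPerm \<tau> \<tau>' n = alt_prod IntPerm \<tau>' \<tau> n" if "m = enat n" for n
  proof -
    have "n = 2 * k" using that m by (auto split: if_splits)
    moreover have "\<sigma> [^]\<^bsub>IntPerm\<^esub> k = \<one>\<^bsub>IntPerm\<^esub>"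
      using \<sigma>1[of "int k"] by (simp add: int_pow_int)
    ultimately show ?thesis
      using S.even_relation_iff[OF \<tau>, of \<tau>' k] \<tau> by simp
  qed
  from Artin_universal[OF group_BijGroup \<tau> \<open>\<tau>' \<in> carrier IntPerm\<close> this]
  obtain \<rho> where \<rho>: "\<rho> \<in> hom G IntPerm" "\<rho> x = \<tau>" "\<rho> y = \<tau>'"
    unfolding G by blast
  interpret \<rho>: group_hom G IntPerm \<rho>
    using \<rho> by (simp add: group_hom_def group_hom_axioms_def group_BijGroup)
  have \<rho>u: "\<rho> (u [^] i) = \<sigma> [^]\<^bsub>IntPerm\<^esub> i" for i :: int
    using \<rho> by (simp add: \<rho>.hom_int_pow)
  have \<rho>w: "\<rho> (w [^] j) = \<one>\<^bsub>IntPerm\<^esub>" for j :: int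
    using \<rho>u[of "int k * j"] \<sigma>1[of "int k * j"] by (simp add: int_pow_pow)
  have \<rho>x: "\<rho> (x [^] i \<otimes> w [^] j) = \<tau> [^]\<^bsub>IntPerm\<^esub> i" for i j :: int
    using \<rho>(2) \<rho>w[of j] \<tau> by (simp add: \<rho>.hom_int_pow)
  show "central_amalgam G factors centre"
  proof (rule ping_pong[OF \<rho>(1)])
    show "\<rho> z = \<one>\<^bsub>IntPerm\<^esub>" if "z \<in> centre" for z
      using that \<rho>w mem_centre by metis
    show "\<rho> a v > 0" if "a \<in> factors True" "a \<notin> centre" "v \<le> 0" for a v
    proof -
      from that(1) obtain i :: int where i: "a = u [^] i" by (rule factor_TrueE)
      have "\<not> int k dvd i"
        using that(2) i by (auto simp: mem_centre int_pow_pow dvd_def)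
      then show ?thesis using \<sigma>2 that i \<rho>u by simp
    qed
    show "\<rho> a v < 0" if "a \<in> factors False" "a \<notin> centre" "v \<ge> 0" for a v
    proof -
      from that(1) obtain i j :: int where i: "a = x [^] i \<otimes> w [^] j" by (rule factor_FalseE)
      have "i \<noteq> 0"
        using that(2) i by (auto simp: centre_def)
      then show ?thesis using \<tau>2 that i \<rho>x by simp
    qed
  qed
qed

lemma even_m: "m = enat n \<Longrightarrow> even n"
  using m by (auto split: if_splits)

text \<open>\<open>g [^] n\<close> centralises \<open>x\<close>, which lies in
  \<open>factors False\<close> outside \<open>centre\<close>, so it lies in
  \<open>factors False\<close>. If it is outside \<open>centre\<close>, the same argument puts
  \<open>g\<close> there; otherwise \<open>g\<close> is torsion modulo \<open>centre\<close> and
  conjugate into a factor.\<close>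

lemma commute_pow_cases:
  assumes g: "g \<in> carrier G" and n: "n > 0"
    and comm: "x \<otimes> g [^] (n::nat) = g [^] n \<otimes> x"
  obtains i j :: int where "g = x [^] i \<otimes> w [^] j"
  | b and t :: int where "b \<in> carrier G" "g = b \<otimes> u [^] t \<otimes> inv b" "int k dvd t * int n"
proof -
  \<comment> \<open>\<open>\<phi>\<close> vanishes on \<open>u\<close>, hence on the centre, and
    detects exponents of \<open>x\<close>; \<open>\<psi>\<close> takes the value 1 on
    \<open>u\<close> and detects exponents of \<open>u\<close>.\<close>
  obtain \<phi> where \<phi>: "\<phi> \<in> hom G integer_group" "\<phi> x = 1" "\<phi> y = - 1"
    by (rule Artin_degree[of m 1 "- 1"]) (use even_m G in auto)
  obtain \<psi> where \<psi>: "\<psi> \<in> hom G integer_group" "\<psi> x = 0" "\<psi> y = 1"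
    by (rule Artin_degree[of m 0 1]) (use even_m G in auto)
  note \<phi>_simps = hom_integer_group[OF \<phi>(1)] \<phi>(2,3)
  note \<psi>_simps = hom_integer_group[OF \<psi>(1)] \<psi>(2,3)
  have x: "x \<in> factors False" "x \<notin> centre"
  proof -
    show "x \<in> factors False" by (rule x_factor)
    have "\<phi> z = 0" if "z \<in> centre" for z
      using that by (auto simp: centre_def \<phi>_simps)
    then show "x \<notin> centre" using \<phi> by fastforce
  qed
  have gn: "g [^] n \<in> factors False"
    using factor_centralizer[OF x, of "g [^] n"] g comm by simp
  show thesis
  proof (cases "g [^] n \<in> centre")
    case False
    then have "g \<in> factors False"
      using factor_centralizer[OF gn False g] nat_pow_comm[of g 1 n] g by simp
    then show thesis using that(1) by (rule factor_FalseE)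
  next
    case True
    from torsion_conj_factor[OF g n True] obtain b c i where
      bc: "b \<in> carrier G" "c \<in> factors i" "g = b \<otimes> c \<otimes> inv b" "c [^] n \<in> centre" .
    show thesis
    proof (cases i)
      case True
      with bc have "c \<in> factors True" by simp
      then obtain t :: int where t: "c = u [^] t" by (rule factor_TrueE)
      obtain j :: int where j: "c [^] n = w [^] j" using bc(4) by (rule centreE)
      have "\<psi> (c [^] n) = \<psi> (w [^] j)" using j by simp
      then have "int n * t = j * int k"
        by (simp add: \<psi>_simps t)
      then show thesis using that(2)[of b t] bc t by (simp add: mult.commute)
    next
      case False
      with bc have "c \<in> factors False" by simp
      then obtain t l :: int where t: "c = x [^] t \<otimes> w [^] l" by (rule factor_FalseE)
      obtain j :: int where j: "c [^] n = w [^] j" using bc(4) by (rule centreE)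
      have "\<phi> (c [^] n) = \<phi> (w [^] j)" using j by simp
      \<comment> \<open>As \<open>\<phi>\<close> kills \<open>w\<close>, the exponent of
        \<open>x\<close> vanishes, so \<open>c\<close> is a power of \<open>w\<close> and hence of
        \<open>u\<close>.\<close>
      then have "t = 0" using n by (simp add: \<phi>_simps t)
      then have c: "c = u [^] (int k * l)" using t by (simp add: int_pow_pow)
      then show thesis using that(2)[of b "int k * l"] bc by simp
    qed
  qed
qed

end

section \<open>Dihedral Artin groups with odd label\<close>

locale odd_artin = artin_group +
  fixes h :: nat
  assumes h: "h > 0" and m: "m = enat (Suc (2 * h))"
begin

text \<open>\<open>D\<close> is the Garside element \<open>\<Delta>\<close>, \<open>w\<close> is
  \<open>\<delta> = \<Delta>\<^sup>2\<close>, and \<open>N\<close> is the label.\<close>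

abbreviation "D \<equiv> u [^] h \<otimes> x"
abbreviation "w \<equiv> D \<otimes> D"
abbreviation "N \<equiv> int (Suc (2 * h))"

definition "factors b = (if b then range (\<lambda>i::int. u [^] i) else range (\<lambda>i::int. D [^] i))"

definition "centre = range (\<lambda>j::int. w [^] j)"

lemma D_eq: "D = y \<otimes> u [^] h"
  using Artin_relation[OF m] odd_relation_iff[of x y h] G by simp

lemma D_alt_prod: "D = alt_prod G x y (Suc (2 * h))"
  by (simp only: alt_prod_odd[OF gens_carrier])

text \<open>The two expressions \<open>u [^] h \<otimes> x\<close> and
  \<open>y \<otimes> u [^] h\<close> of \<open>D\<close> multiply to a power of
  \<open>u\<close>.\<close>

lemma w_eq: "w = u [^] N"
proof -
  have "w = (u [^] h \<otimes> x) \<otimes> (y \<otimes> u [^] h)"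
    using D_eq by simp
  also have "\<dots> = u [^] h \<otimes> u \<otimes> u [^] h"
    by (simp add: m_assoc)
  also have "\<dots> = u [^] Suc h \<otimes> u [^] h"
    by simp
  also have "\<dots> = u [^] Suc (2 * h)"
    by (simp only: nat_pow_mult m_closed gens_carrier) (simp add: mult_2)
  finally show ?thesis by (simp only: int_pow_int)
qed

lemma x_eq: "inv (u [^] h) \<otimes> D = x"
  by simp

lemma D_pow_double: "D [^] (2 * l) = w [^] l" for l :: int
proof -
  have "D [^] (2::int) = w"
    using int_pow_mult[of D 1 1] by simp
  then show ?thesis using int_pow_pow[of D 2 l] by simp
qed

lemma u_pow_N: "u [^] (N * l) = w [^] l" for l :: int
  unfolding w_eq by (simp only: int_pow_pow m_closed gens_carrier)

text \<open>\<open>w\<close> is a power of \<open>u\<close> and of \<open>D\<close>, so it commutes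
  with both, and with \<open>x\<close>, which is a product of powers of them.\<close>

lemma w_central:
  assumes "g \<in> carrier G"
  shows "w [^] (j::int) \<otimes> g = g \<otimes> w [^] j"
proof -
  have wu: "w \<otimes> u = u \<otimes> w"
    unfolding w_eq by (rule commute_int_pow) simp_all
  have wD: "w \<otimes> D = D \<otimes> w" by (simp add: m_assoc)
  have "inv (u [^] h) \<otimes> w = w \<otimes> inv (u [^] h)"
    using wu by (intro commute_inv group_commutes_pow) simp_all
  then have "w \<otimes> (inv (u [^] h) \<otimes> D) = inv (u [^] h) \<otimes> w \<otimes> D"
    by (simp only: m_assoc[symmetric] inv_closed nat_pow_closed m_closed gens_carrier)
  also have "\<dots> = (inv (u [^] h) \<otimes> D) \<otimes> w"
    using wD by (simp only: m_assoc inv_closed nat_pow_closed m_closed gens_carrier)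
  finally have "w \<otimes> x = x \<otimes> w" unfolding x_eq .
  then have "w \<otimes> g = g \<otimes> w"
    by (rule centralI[OF _ _ wu assms, rotated]) simp
  then show ?thesis using assms by (intro commute_int_pow) simp_all
qed

lemma centreE:
  assumes "a \<in> centre"
  obtains j :: int where "a = w [^] j"
  using assms unfolding centre_def image_iff by blast

lemma w_centre [simp]: "w [^] (j::int) \<in> centre"
  by (simp add: centre_def)

lemma factor_TrueE:
  assumes "a \<in> factors True"
  obtains i :: int where "a = u [^] i"
  using assms unfolding factors_def image_iff by (simp, blast)

lemma factor_FalseE:
  assumes "a \<in> factors False"
  obtains i :: int where "a = D [^] i"
  using assms unfolding factors_def image_iff by (simp, blast)

lemma u_factor: "u [^] (i::int) \<in> factors True"
  by (simp add: factors_def)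

lemma D_factor: "D [^] (i::int) \<in> factors False"
  by (simp add: factors_def)

lemma central_factors: "central_factors G factors centre"
proof (intro central_factors.intro central_factors_axioms.intro)
  show "Group.group G" ..
  show "subgroup (factors i) G" for i
    using subgroup_int_powers[of u] subgroup_int_powers[of D]
    by (cases i) (simp_all add: factors_def)
  show "subgroup centre G"
    unfolding centre_def by (rule subgroup_int_powers) simp
  show "centre \<subseteq> factors i" for i
  proof
    fix a assume "a \<in> centre"
    then obtain j :: int where "a = w [^] j" by (rule centreE)
    then show "a \<in> factors i"
      using u_factor[of "N * j"] D_factor[of "2 * j"]
      by (cases i) (simp_all only: u_pow_N D_pow_double)
  qed
  show "z \<otimes> g = g \<otimes> z" if "z \<in> centre" "g \<in> carrier G" for z g
    using that(1) by (rule centreE) (simp only: w_central[OF that(2)])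
  show "a \<otimes> b = b \<otimes> a" if ab: "a \<in> factors i" "b \<in> factors i" for a b i
  proof (cases i)
    case True
    with ab have "a \<in> factors True" "b \<in> factors True" by simp_all
    then show ?thesis
      by (elim factor_TrueE) (simp add: add.commute flip: int_pow_mult)
  next
    case False
    with ab have "a \<in> factors False" "b \<in> factors False" by simp_all
    then show ?thesis
      by (elim factor_FalseE) (simp add: add.commute flip: int_pow_mult)
  qed
  show "carrier G = generate G (factors True \<union> factors False)"
  proof (rule generate_eqI)
    show S: "factors True \<union> factors False \<subseteq> carrier G"
      by (auto simp: factors_def)
    have "inv (u [^] h) \<in> factors True"
      using u_factor[of "- int h"] by (simp add: int_pow_neg int_pow_int)
    moreover have "D \<in> factors False" using D_factor[of 1] by simp
    ultimately have "inv (u [^] h) \<otimes> D \<in> generate G (factors True \<union> factors False)"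
      by (intro generate.eng generate.incl) simp_all
    then show "x \<in> generate G (factors True \<union> factors False)" unfolding x_eq .
    show "u \<in> generate G (factors True \<union> factors False)"
      using u_factor[of 1] by (intro generate.incl) simp
  qed
qed

sublocale central_factors G factors centre
  by (rule central_factors)

lemma degree:
  obtains \<phi> :: "word set \<Rightarrow> int" where "\<phi> \<in> hom G integer_group" "\<phi> x = 1" "\<phi> y = 1"
  by (rule Artin_degree[of m 1 1]) (use G in auto)

text \<open>The action sends \<open>u\<close> to \<open>\<sigma>\<close>, of order \<open>N\<close>,
  and \<open>D\<close> to \<open>\<tau>\<close>, of order 2.\<close>

sublocale central_amalgam G factors centre
proof -
  interpret S: group IntPerm by (rule group_BijGroup)
  have "Suc (2 * h) \<noteq> 1" "(2::nat) \<noteq> 1" using h by simp_all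
  from ping_pong_perms[OF this]
  obtain \<sigma> \<tau> where \<sigma>: "\<sigma> \<in> carrier IntPerm" and \<tau>: "\<tau> \<in> carrier IntPerm"
    and \<sigma>1: "\<And>i. N dvd i \<Longrightarrow> \<sigma> [^]\<^bsub>IntPerm\<^esub> i = \<one>\<^bsub>IntPerm\<^esub>"
    and \<tau>1: "\<And>i. int 2 dvd i \<Longrightarrow> \<tau> [^]\<^bsub>IntPerm\<^esub> i = \<one>\<^bsub>IntPerm\<^esub>"
    and \<sigma>2: "\<And>i v. \<not> N dvd i \<Longrightarrow> v \<le> 0 \<Longrightarrow> (\<sigma> [^]\<^bsub>IntPerm\<^esub> i) v > 0"
    and \<tau>2: "\<And>i v. \<not> int 2 dvd i \<Longrightarrow> v \<ge> 0 \<Longrightarrow> (\<tau> [^]\<^bsub>IntPerm\<^esub> i) v < 0"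
    by metis
  \<comment> \<open>\<open>x'\<close> and \<open>y'\<close> are solved from the requirements that
    \<open>u [^] h \<otimes> x\<close> act as \<open>\<tau>\<close> and \<open>x \<otimes> y\<close>
    as \<open>\<sigma>\<close>.\<close>
  define x' where "x' = inv\<^bsub>IntPerm\<^esub> (\<sigma> [^]\<^bsub>IntPerm\<^esub> h) \<otimes>\<^bsub>IntPerm\<^esub> \<tau>"
  define y' where "y' = inv\<^bsub>IntPerm\<^esub> x' \<otimes>\<^bsub>IntPerm\<^esub> \<sigma>"
  have x' [simp]: "x' \<in> carrier IntPerm" and y' [simp]: "y' \<in> carrier IntPerm"
    using \<sigma> \<tau> by (simp_all add: x'_def y'_def)
  have u': "x' \<otimes>\<^bsub>IntPerm\<^esub> y' = \<sigma>" and D': "\<sigma> [^]\<^bsub>IntPerm\<^esub> h \<otimes>\<^bsub>IntPerm\<^esub> x' = \<tau>"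
    using \<sigma> \<tau> by (simp_all add: y'_def) (simp add: x'_def)
  have "\<tau> \<otimes>\<^bsub>IntPerm\<^esub> \<tau> = \<one>\<^bsub>IntPerm\<^esub>"
    using \<tau>1[of 2] S.int_pow_mult[OF \<tau>, of 1 1] \<tau> by simp
  then have \<tau>_inv: "inv\<^bsub>IntPerm\<^esub> \<tau> = \<tau>"
    using \<tau> by (intro S.inv_equality)
  have "y' \<otimes>\<^bsub>IntPerm\<^esub> \<sigma> [^]\<^bsub>IntPerm\<^esub> h = inv\<^bsub>IntPerm\<^esub> \<tau> \<otimes>\<^bsub>IntPerm\<^esub>
      (\<sigma> [^]\<^bsub>IntPerm\<^esub> h \<otimes>\<^bsub>IntPerm\<^esub> (\<sigma> [^]\<^bsub>IntPerm\<^esub> Suc h))"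
    unfolding S.nat_pow_Suc2[OF \<sigma>]
    using \<sigma> \<tau> by (simp add: y'_def x'_def S.inv_mult_group S.m_assoc)
  also have "\<sigma> [^]\<^bsub>IntPerm\<^esub> h \<otimes>\<^bsub>IntPerm\<^esub> (\<sigma> [^]\<^bsub>IntPerm\<^esub> Suc h) = \<sigma> [^]\<^bsub>IntPerm\<^esub> N"
    by (simp only: S.nat_pow_mult[OF \<sigma>] int_pow_int) (simp add: mult_2)
  also have "\<sigma> [^]\<^bsub>IntPerm\<^esub> N = \<one>\<^bsub>IntPerm\<^esub>" by (rule \<sigma>1) simp
  finally have "y' \<otimes>\<^bsub>IntPerm\<^esub> \<sigma> [^]\<^bsub>IntPerm\<^esub> h = \<tau>"
    using \<tau> \<tau>_inv by simp
  then have "alt_prod IntPerm x' y' (Suc (2 * h)) = alt_prod IntPerm y' x' (Suc (2 * h))"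
    unfolding S.odd_relation_iff[OF x' y'] u' D' by simp
  then have "alt_prod IntPerm x' y' n = alt_prod IntPerm y' x' n" if "m = enat n" for n
    using that m by (metis enat.inject)
  from Artin_universal[OF group_BijGroup x' y' this]
  obtain \<rho> where \<rho>: "\<rho> \<in> hom G IntPerm" "\<rho> x = x'" "\<rho> y = y'"
    unfolding G by blast
  interpret \<rho>: group_hom G IntPerm \<rho>
    using \<rho> by (simp add: group_hom_def group_hom_axioms_def group_BijGroup)
  have \<rho>u: "\<rho> (u [^] i) = \<sigma> [^]\<^bsub>IntPerm\<^esub> i" for i :: int
    using \<rho> u' by (simp add: \<rho>.hom_int_pow)
  have \<rho>D: "\<rho> (D [^] i) = \<tau> [^]\<^bsub>IntPerm\<^esub> i" for i :: int
    using \<rho> u' D' by (simp add: \<rho>.hom_int_pow \<rho>.hom_nat_pow)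
  show "central_amalgam G factors centre"
  proof (rule ping_pong[OF \<rho>(1)])
    show "\<rho> z = \<one>\<^bsub>IntPerm\<^esub>" if "z \<in> centre" for z
      using that
    proof (rule centreE)
      fix j :: int assume "z = w [^] j"
      then show ?thesis using \<rho>D[of "2 * j"] \<tau>1[of "2 * j"] by (simp only: D_pow_double) simp
    qed
    show "\<rho> a v > 0" if "a \<in> factors True" "a \<notin> centre" "v \<le> 0" for a v
    proof -
      from that(1) obtain i :: int where i: "a = u [^] i" by (rule factor_TrueE)
      have "\<not> N dvd i"
      proof
        assume "N dvd i"
        then obtain l where "i = N * l" ..
        then have "a = w [^] l" using i u_pow_N by (simp only:)
        then show False using that(2) by simp
      qed
      then show ?thesis using \<sigma>2 that i \<rho>u by simp
    qed
    show "\<rho> a v < 0" if "a \<in> factors False" "a \<notin> centre" "v \<ge> 0" for a v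
    proof -
      from that(1) obtain i :: int where i: "a = D [^] i" by (rule factor_FalseE)
      have "\<not> int 2 dvd i"
      proof
        assume "int 2 dvd i"
        then obtain l where "i = 2 * l" by (auto elim: dvdE)
        then have "a = w [^] l" using i D_pow_double by (simp only:)
        then show False using that(2) by simp
      qed
      then show ?thesis using \<tau>2 that i \<rho>D by simp
    qed
  qed
qed

text \<open>For this choice of \<open>s\<close> and \<open>d\<close> the element \<open>c\<close> of
  the locale is \<open>x\<close>. Degrees keep both outside the centre, whose elements have degree
  divisible by \<open>2 * N\<close>: \<open>D\<close> has degree \<open>N\<close> and
  \<open>s\<close> has degree \<open>- 2 * h\<close>.\<close>

sublocale half_amalgam G factors centre "inv (u [^] h)" D
proof
  obtain \<phi> where \<phi>: "\<phi> \<in> hom G integer_group" "\<phi> x = 1" "\<phi> y = 1" by (rule degree)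
  note \<phi>_simps = hom_integer_group[OF \<phi>(1)] \<phi>(2,3)
  have Z: "2 * N dvd \<phi> z" if "z \<in> centre" for z
    using that
  proof (rule centreE)
    fix j :: int assume "z = w [^] j"
    then have "\<phi> z = 2 * N * j" by (simp add: \<phi>_simps algebra_simps)
    then show ?thesis by simp
  qed
  show "inv (u [^] h) \<in> factors True"
    using u_factor[of "- int h"] by (simp add: int_pow_neg int_pow_int)
  have "\<phi> (inv (u [^] h)) = - 2 * int h" by (simp add: \<phi>_simps)
  moreover have "\<not> 2 * N dvd - 2 * int h"
    using h zdvd_imp_le[of "2 * N" "2 * int h"] by auto
  ultimately show "inv (u [^] h) \<notin> centre" using Z by metis
  show "D \<in> factors False" using D_factor[of 1] by simp
  have "\<phi> D = N" by (simp add: \<phi>_simps)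
  moreover have "\<not> 2 * N dvd N" using zdvd_imp_le[of "2 * N" N] by auto
  ultimately show "D \<notin> centre" using Z by metis
  show "inv D \<otimes> a \<in> centre" if "a \<in> factors False" "a \<notin> centre" for a
  proof -
    from that(1) obtain i :: int where i: "a = D [^] i" by (rule factor_FalseE)
    have "odd i"
    proof
      assume "even i"
      then obtain l where "i = 2 * l" ..
      then have "a = w [^] l" using i D_pow_double by (simp only:)
      then show False using that(2) by simp
    qed
    then obtain l where l: "i = 2 * l + 1" by (elim oddE)
    have "inv D \<otimes> a = D [^] (- 1 :: int) \<otimes> D [^] i"
      using i by (simp add: int_pow_neg)
    also have "\<dots> = D [^] (2 * l)"
      unfolding l by (simp flip: int_pow_mult)
    also have "\<dots> = w [^] l" by (rule D_pow_double)
    finally show ?thesis by simp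
  qed
qed

text \<open>\<open>c_pow_centralizer\<close> writes \<open>g [^] n\<close> as a central element
  times \<open>x [^] t\<close>. For \<open>t \<noteq> 0\<close>, \<open>g\<close> commutes with
  \<open>x [^] t\<close> and the same lemma applies to \<open>g\<close>; for \<open>t = 0\<close>,
  \<open>g\<close> is torsion modulo the centre.\<close>

lemma commute_pow_cases:
  assumes g: "g \<in> carrier G" and n: "n > 0"
    and comm: "x \<otimes> g [^] (n::nat) = g [^] n \<otimes> x"
  obtains i j :: int where "g = w [^] j \<otimes> x [^] i"
  | b and t :: int where "b \<in> carrier G" "g = b \<otimes> u [^] t \<otimes> inv b" "N dvd t * int n"
  | b and t :: int where "b \<in> carrier G" "g = b \<otimes> D [^] t \<otimes> inv b" "even n"
proof -
  obtain \<phi> where \<phi>: "\<phi> \<in> hom G integer_group" "\<phi> x = 1" "\<phi> y = 1" by (rule degree)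
  note \<phi>_simps = hom_integer_group[OF \<phi>(1)] \<phi>(2,3)
  have cent: "\<exists>t::int. \<exists>z\<in>centre. a = z \<otimes> x [^] t"
    if "a \<in> carrier G" "a \<otimes> x [^] Suc k = x [^] Suc k \<otimes> a" for a k
    using c_pow_centralizer[of a k] that unfolding x_eq by simp
  obtain t :: int and z where tz: "z \<in> centre" "g [^] n = z \<otimes> x [^] t"
    using cent[of "g [^] n" 0] g comm by auto
  show thesis
  proof (cases "t = 0")
    case False
    have z [simp]: "z \<in> carrier G" using tz by simp
    have "g \<otimes> g [^] n = g [^] n \<otimes> g"
      using nat_pow_Suc2[OF g, of n] g by simp
    then have "z \<otimes> (g \<otimes> x [^] t) = z \<otimes> (x [^] t \<otimes> g)"
      using tz g central[OF tz(1) g] by (simp flip: m_assoc)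
    then have comm_t: "x [^] t \<otimes> g = g \<otimes> x [^] t"
      using g by simp
    \<comment> \<open>The centraliser lemma expects an exponent \<open>Suc k\<close>, so
      \<open>t\<close> is replaced by its absolute value.\<close>
    define k where "k = nat (\<bar>t\<bar> - 1)"
    have "x [^] Suc k \<otimes> g = g \<otimes> x [^] Suc k"
    proof (cases "t > 0")
      case True
      then have "t = int (Suc k)" by (simp add: k_def)
      then show ?thesis using comm_t by (metis int_pow_int)
    next
      case neg: False
      then have "- t = int (Suc k)" using False by (simp add: k_def)
      moreover have "x [^] (- t) \<otimes> g = g \<otimes> x [^] (- t)"
        using commute_inv[OF comm_t] g by (simp add: int_pow_neg)
      ultimately show ?thesis by (metis int_pow_int)
    qed
    then obtain i :: int and z' where z': "z' \<in> centre" "g = z' \<otimes> x [^] i"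
      using cent[OF g, of k] by auto
    from z'(1) obtain j :: int where "z' = w [^] j" by (rule centreE)
    then show thesis using that(1) z' by simp
  next
    case True
    then have "g [^] n \<in> centre" using tz by simp
    from torsion_conj_factor[OF g n this] obtain b c i where
      bc: "b \<in> carrier G" "c \<in> factors i" "g = b \<otimes> c \<otimes> inv b" "c [^] n \<in> centre" .
    from bc(4) obtain j :: int where j: "c [^] n = w [^] j" by (rule centreE)
    have deg: "\<phi> (c [^] n) = j * (2 * N)"
      unfolding j by (simp add: \<phi>_simps)
    show thesis
    proof (cases i)
      case True
      with bc have "c \<in> factors True" by simp
      then obtain s :: int where s: "c = u [^] s" by (rule factor_TrueE)
      have "\<phi> (c [^] n) = 2 * (s * int n)"
        unfolding s by (simp add: \<phi>_simps)
      then have "s * int n = N * j" using deg by (simp add: algebra_simps)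
      then show thesis using that(2)[of b s] bc s by simp
    next
      case False
      with bc have "c \<in> factors False" by simp
      then obtain s :: int where s: "c = D [^] s" by (rule factor_FalseE)
      have "\<phi> (c [^] n) = s * int n * N"
        unfolding s by (simp add: \<phi>_simps)
      then have "s * int n * N = (2 * j) * N" using deg by (simp only: ac_simps)
      then have "s * int n = 2 * j" by (subst (asm) mult_right_cancel) simp_all
      \<comment> \<open>An even \<open>s\<close> makes \<open>c\<close> a power of \<open>w\<close>
        and so of \<open>u\<close>; a genuine power of \<open>D\<close> therefore needs an even
        \<open>n\<close>.\<close>
      then have "even s \<or> even n"
        by (metis dvd_triv_left even_mult_iff even_of_nat)
      then show thesis
      proof
        assume "even n"
        then show thesis using that(3)[of b s] bc s by simp
      next
        assume "even s"
        then obtain l where "s = 2 * l" ..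
        then have "c = u [^] (N * l)"
          using s by (simp only: D_pow_double u_pow_N)
        then show thesis using that(2)[of b "N * l"] bc by simp
      qed
    qed
  qed
qed

text \<open>Of the three forms of \<open>g\<close>, the first makes \<open>g\<close> commute with
  \<open>x\<close> and gives \<open>a = x\<close>, and the third contradicts the odd exponent. In
  the second, degrees leave a conjugate of \<open>u\<close> itself, and the conjugator has to be
  found.\<close>

lemma odd_relation_cases:
  assumes a: "a \<in> carrier G"
    and rel: "(x \<otimes> a) [^] (n::nat) \<otimes> x = a \<otimes> (x \<otimes> a) [^] n"
  shows "a = x \<or> (Suc (2 * h) dvd Suc (2 * n) \<and> (\<exists>t::int. a = x [^] t \<otimes> y \<otimes> x [^] (- t)))"
proof -
  obtain \<phi> where \<phi>: "\<phi> \<in> hom G integer_group" "\<phi> x = 1" "\<phi> y = 1" by (rule degree)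
  note \<phi>_simps = hom_integer_group[OF \<phi>(1)] \<phi>(2,3)
  define g where "g = x \<otimes> a"
  have g: "g \<in> carrier G" and a_eq: "a = inv x \<otimes> g" using a by (simp_all add: g_def)
  \<comment> \<open>Both sides contain \<open>g [^] n\<close>, so comparing degrees gives
    \<open>a\<close> the degree of \<open>x\<close>.\<close>
  have "\<phi> (g [^] n \<otimes> x) = \<phi> (a \<otimes> g [^] n)"
    using rel by (simp add: g_def)
  then have "\<phi> a = 1" using a g by (simp add: \<phi>_simps)
  then have deg: "\<phi> g = 2" using a by (simp add: g_def \<phi>_simps)
  have "x \<otimes> g [^] Suc (2 * n) = g [^] Suc (2 * n) \<otimes> x"
    unfolding g_def by (rule odd_relation_commute[OF _ a rel]) simp
  from commute_pow_cases[OF g zero_less_Suc this] show ?thesis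
  proof cases
    case (1 i j)
    have "g \<otimes> x = w [^] j \<otimes> (x [^] i \<otimes> x)"
      unfolding 1 by (simp add: m_assoc)
    also have "x [^] i \<otimes> x = x \<otimes> x [^] i"
      by (rule commute_int_pow) simp_all
    also have "w [^] j \<otimes> (x \<otimes> x [^] i) = w [^] j \<otimes> x \<otimes> x [^] i"
      by (simp add: m_assoc)
    also have "\<dots> = x \<otimes> w [^] j \<otimes> x [^] i"
      by (simp only: w_central gens_carrier)
    also have "\<dots> = x \<otimes> g"
      unfolding 1 by (simp add: m_assoc)
    finally have gx: "x \<otimes> g = g \<otimes> x" by simp
    have "x \<otimes> (a \<otimes> x) = x \<otimes> (x \<otimes> a)"
      using gx a by (simp add: g_def m_assoc)
    then have "x \<otimes> a = a \<otimes> x"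
      using a by simp
    then show ?thesis using commute_relation_eq[OF _ a _ rel] by simp
  next
    case (2 b t)
    have "\<phi> g = 2 * t"
      unfolding 2 using 2(1) by (simp add: \<phi>_simps)
    then have t: "t = 1" using deg by simp
    have gb: "g = b \<otimes> u \<otimes> inv b" using 2 t by simp
    have dvd: "Suc (2 * h) dvd Suc (2 * n)" using 2(3) t by (simp only: mult_1 int_dvd_int_iff)
    then obtain l where l: "Suc (2 * n) = Suc (2 * h) * l" ..
    \<comment> \<open>\<open>Suc (2 * n)\<close> is an odd multiple of the label, so
      \<open>n\<close> is \<open>h\<close> plus a multiple of \<open>N\<close>, and
      \<open>u [^] n\<close> is \<open>u [^] h\<close> up to the centre.\<close>
    have "odd l"
      using l by (metis even_Suc even_mult_iff dvd_triv_left)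
    then obtain r where r: "l = 2 * r + 1" by (elim oddE)
    have n: "int n = int h + N * int r"
    proof -
      have "2 * n = 2 * (h + Suc (2 * h) * r)" using l r by (simp add: algebra_simps)
      then have "n = h + Suc (2 * h) * r" by simp
      then show ?thesis by (simp only: of_nat_add of_nat_mult)
    qed
    \<comment> \<open>Conjugating by \<open>inv b\<close> turns \<open>g\<close> into
      \<open>u\<close> and \<open>x\<close> into \<open>X\<close>. \<open>E\<close> is the element
      squared in \<open>c_conj_square\<close>, where \<open>inv s\<close> is
      \<open>u [^] h\<close>.\<close>
    define X where "X = inv b \<otimes> x \<otimes> b"
    define E where "E = u [^] h \<otimes> X"
    have [simp]: "X \<in> carrier G" "E \<in> carrier G" using 2(1) by (simp_all add: X_def E_def)
    have un: "u [^] n = w [^] int r \<otimes> u [^] h"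
    proof -
      have "u [^] n = u [^] (N * int r + int h)"
        using n by (metis add.commute int_pow_int)
      also have "\<dots> = u [^] (N * int r) \<otimes> u [^] int h"
        by (rule int_pow_mult) simp
      finally show ?thesis by (simp only: u_pow_N int_pow_int)
    qed
    have "x \<otimes> g [^] n \<otimes> x = g [^] Suc n"
      using rel nat_pow_Suc2[OF g, of n] a by (simp add: g_def m_assoc)
    then have "X \<otimes> u [^] n \<otimes> X = u [^] Suc n"
    proof -
      have gn: "g [^] k = b \<otimes> u [^] k \<otimes> inv b" for k :: nat
        unfolding gb using 2(1) by (simp add: conj_nat_pow)
      have "X \<otimes> u [^] n \<otimes> X = inv b \<otimes> (x \<otimes> g [^] n \<otimes> x) \<otimes> b"
        unfolding gn X_def using 2(1) by (simp add: m_assoc)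
      also have "\<dots> = inv b \<otimes> (b \<otimes> u [^] Suc n \<otimes> inv b) \<otimes> b"
        using \<open>x \<otimes> g [^] n \<otimes> x = g [^] Suc n\<close> gn by (simp only:)
      also have "\<dots> = u [^] Suc n"
        using 2(1) by (simp add: m_assoc)
      finally show ?thesis .
    qed
    then have "u [^] n \<otimes> X \<otimes> (u [^] n \<otimes> X) = u [^] n \<otimes> u [^] Suc n"
      by (simp add: m_assoc)
    also have "\<dots> = u [^] (Suc (2 * n))"
      by (simp only: nat_pow_mult m_closed gens_carrier) (simp add: mult_2)
    also have "\<dots> = w [^] int l"
      unfolding l by (metis int_pow_int of_nat_mult u_pow_N)
    \<comment> \<open>\<open>u [^] n \<otimes> X\<close> equals
      \<open>w [^] int r \<otimes> E\<close> and has a central square; dropping the central factors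
      leaves the square of \<open>E\<close> central.\<close>
    finally have "(w [^] int r \<otimes> E) \<otimes> (w [^] int r \<otimes> E) = w [^] int l"
      unfolding un E_def by (simp only: m_assoc m_closed int_pow_closed nat_pow_closed gens_carrier \<open>X \<in> carrier G\<close>)
    moreover have "(w [^] int r \<otimes> E) \<otimes> (w [^] int r \<otimes> E)
        = w [^] int r \<otimes> (w [^] int r \<otimes> (E \<otimes> E))"
    proof -
      have "(w [^] int r \<otimes> E) \<otimes> (w [^] int r \<otimes> E) = w [^] int r \<otimes> (E \<otimes> w [^] int r) \<otimes> E"
        by (simp add: m_assoc)
      also have "E \<otimes> w [^] int r = w [^] int r \<otimes> E"
        by (simp only: w_central \<open>E \<in> carrier G\<close>)
      finally show ?thesis by (simp add: m_assoc)
    qed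
    ultimately have "w [^] int r \<otimes> (w [^] int r \<otimes> (E \<otimes> E)) \<in> centre"
      by simp
    then have "E \<otimes> E \<in> centre"
      using Z_mult_iff1[of "w [^] int r"] by simp
    then obtain s :: int and p where p: "p \<in> factors True" "b = x [^] s \<otimes> p"
      using c_conj_square[OF 2(1)] unfolding x_eq E_def X_def by (auto simp: inv_inv)
    from p(1) obtain i :: int where i: "p = u [^] i" by (rule factor_TrueE)
    \<comment> \<open>\<open>p\<close> is a power of \<open>u\<close> and cancels, so
      \<open>g\<close> is the conjugate of \<open>u\<close> by \<open>x [^] s\<close>.\<close>
    have "g = x [^] s \<otimes> (u [^] i \<otimes> u \<otimes> inv (u [^] i)) \<otimes> inv (x [^] s)"
      unfolding gb p(2) i by (simp add: m_assoc inv_mult_group)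
    also have "u [^] i \<otimes> u = u \<otimes> u [^] i"
      by (rule commute_int_pow) simp_all
    also have "u \<otimes> u [^] i \<otimes> inv (u [^] i) = u" by (simp add: m_assoc)
    finally have "a = inv x \<otimes> (x [^] s \<otimes> u \<otimes> inv (x [^] s))"
      using a_eq by simp
    also have "\<dots> = inv x \<otimes> (x [^] s \<otimes> x) \<otimes> y \<otimes> inv (x [^] s)"
      by (simp add: m_assoc)
    also have "x [^] s \<otimes> x = x \<otimes> x [^] s"
      by (rule commute_int_pow) simp_all
    also have "inv x \<otimes> (x \<otimes> x [^] s) \<otimes> y \<otimes> inv (x [^] s) = x [^] s \<otimes> y \<otimes> x [^] (- s)"
      by (simp add: int_pow_neg)
    finally show ?thesis using dvd by blast
  next
    case (3 b t)
    then show ?thesis by simp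
  qed
qed

end

section \<open>Homomorphisms fixing the first generator\<close>

text \<open>Dividing \<open>k\<close> and \<open>t\<close> by their gcd makes them coprime, so the
  cofactor of \<open>k\<close> divides \<open>n\<close>. With \<open>n\<close> half the label of
  \<open>A\<close> this is the condition on \<open>q\<close>.\<close>

lemma div_gcd_dvd:
  fixes k t n :: int
  assumes "k > 0" "k dvd t * n"
  shows "k div gcd t k dvd n"
proof -
  obtain k' t' where k': "k = gcd t k * k'" and t': "t = gcd t k * t'"
    by (metis dvdE gcd_dvd1 gcd_dvd2)
  have pos: "gcd t k \<noteq> 0" using assms by simp
  have "coprime k' t'"
    using gcd_coprime[of t k t' k'] k' t' pos by (simp add: mult.commute coprime_commute)
  moreover have "k' dvd t' * n"
  proof -
    have "gcd t k * k' dvd gcd t k * (t' * n)"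
      using assms(2) k' t' by (metis mult.assoc)
    then show ?thesis by (rule dvd_times_left_cancel_iff[THEN iffD1, OF pos])
  qed
  ultimately have "k' dvd n" by (simp add: coprime_dvd_mult_right_iff)
  moreover have "k div gcd t k = k'" using k' pos by (metis nonzero_mult_div_cancel_left)
  ultimately show ?thesis by simp
qed

text \<open>Together with \<open>shift_power\<close>, this leads from \<open>x \<otimes> a\<close>
  back to \<open>a\<close>.\<close>

lemma (in artin_group) shift_conj:
  assumes "a \<in> carrier G" "b \<in> carrier G" "v \<in> carrier G" "x \<otimes> a = b \<otimes> v \<otimes> inv b"
  shows "a = inv x \<otimes> b \<otimes> v \<otimes> inv b"
proof -
  have "a = inv x \<otimes> (x \<otimes> a)" using assms(1) by simp
  also have "\<dots> = inv x \<otimes> (b \<otimes> v \<otimes> inv b)" by (simp only: assms(4))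
  finally show ?thesis using assms(2,3) by (simp add: m_assoc)
qed

lemma (in artin_group) shift_power:
  assumes "a \<in> carrier G" "z \<in> carrier G" "z \<otimes> x = x \<otimes> z" "x \<otimes> a = z \<otimes> x [^] (i::int)"
  shows "a = z \<otimes> x [^] (i - 1)"
proof -
  have "a = inv x \<otimes> (x \<otimes> a)" using assms(1) by simp
  also have "\<dots> = inv x \<otimes> z \<otimes> x [^] i" using assms(2) by (simp add: assms(4) m_assoc)
  also have "inv x \<otimes> z = z \<otimes> inv x"
    using assms(2,3) by (intro commute_inv) simp_all
  also have "z \<otimes> inv x \<otimes> x [^] i = z \<otimes> (x [^] (- 1 :: int) \<otimes> x [^] i)"
    using assms(2) by (simp add: m_assoc int_pow_neg)
  also have "x [^] (- 1 :: int) \<otimes> x [^] i = x [^] (i - 1)"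
    by (simp flip: int_pow_mult)
  finally show ?thesis .
qed

context even_artin
begin

lemma w_pow_x: "w [^] (j::int) \<otimes> x = x \<otimes> w [^] j"
  by (rule commute_int_pow[OF xw[symmetric]]) simp_all

lemma even_relation_cases:
  assumes a: "a \<in> carrier G" and n: "n > 0"
    and rel: "alt_prod G x a (2 * n) = alt_prod G a x (2 * n)"
  obtains t1 t2 :: int where "a = w [^] t1 \<otimes> x [^] t2"
  | b and t :: int where "b \<in> carrier G" "a = inv x \<otimes> b \<otimes> u [^] t \<otimes> inv b" "int k dvd t * int n"
proof -
  have g: "x \<otimes> a \<in> carrier G" using a by simp
  have "x \<otimes> (x \<otimes> a) [^] n = (x \<otimes> a) [^] n \<otimes> x"
    using rel even_relation_iff[OF _ a] by simp
  from commute_pow_cases[OF g n this] show thesis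
  proof cases
    case (1 i j)
    have "x \<otimes> a = w [^] j \<otimes> x [^] i"
      unfolding 1 using xw by (intro int_pow_commute) simp_all
    from shift_power[OF a _ w_pow_x this] show thesis using that(1) by simp
  next
    case (2 b t)
    then show thesis using that(2)[of b t] shift_conj[OF a 2(1) _ 2(2)] by simp
  qed
qed

text \<open>Degrees rule out conjugates of powers of \<open>u\<close>, on which
  \<open>\<phi>\<close> vanishes while \<open>\<phi> g = 2\<close>. In the other case they fix the
  exponent of \<open>x\<close> and make the central part trivial.\<close>

lemma odd_relation_eq:
  assumes a: "a \<in> carrier G"
    and rel: "alt_prod G x a (Suc (2 * n)) = alt_prod G a x (Suc (2 * n))"
  shows "a = x"
proof -
  obtain \<phi> where \<phi>: "\<phi> \<in> hom G integer_group" "\<phi> x = 1" "\<phi> y = - 1"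
    by (rule Artin_degree[of m 1 "- 1"]) (use even_m G in auto)
  obtain \<psi> where \<psi>: "\<psi> \<in> hom G integer_group" "\<psi> x = 0" "\<psi> y = 1"
    by (rule Artin_degree[of m 0 1]) (use even_m G in auto)
  note \<phi>_simps = hom_integer_group[OF \<phi>(1)] \<phi>(2,3)
  note \<psi>_simps = hom_integer_group[OF \<psi>(1)] \<psi>(2,3)
  define g where "g = x \<otimes> a"
  have g: "g \<in> carrier G" using a by (simp add: g_def)
  have rel': "g [^] n \<otimes> x = a \<otimes> g [^] n"
    using rel odd_relation_iff[OF _ a] by (simp add: g_def)
  then have "\<phi> (g [^] n \<otimes> x) = \<phi> (a \<otimes> g [^] n)" "\<psi> (g [^] n \<otimes> x) = \<psi> (a \<otimes> g [^] n)"
    by simp_all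
  then have "\<phi> a = 1" "\<psi> a = 0" using a g by (simp_all add: \<phi>_simps \<psi>_simps)
  then have deg: "\<phi> g = 2" "\<psi> g = 0" using a by (simp_all add: g_def \<phi>_simps \<psi>_simps)
  have "x \<otimes> g [^] Suc (2 * n) = g [^] Suc (2 * n) \<otimes> x"
    using rel' unfolding g_def by (intro odd_relation_commute a) simp_all
  from commute_pow_cases[OF g zero_less_Suc this] show ?thesis
  proof cases
    case (1 i j)
    have "i = 2" using deg(1) unfolding 1 by (simp add: \<phi>_simps)
    moreover have kj: "int k * j = 0" using deg(2) unfolding 1 by (auto simp: \<psi>_simps)
    \<comment> \<open>\<open>int k * j = 0\<close> covers both \<open>k = 0\<close>, where
      \<open>w\<close> is trivial, and \<open>j = 0\<close>.\<close>
    have "w [^] j = \<one>"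
      using int_pow_pow[OF m_closed[OF gens_carrier], of "int k" j] unfolding kj by simp
    ultimately have "x \<otimes> a = \<one> \<otimes> x [^] (2::int)"
      using 1 g_def by simp
    from shift_power[OF a _ _ this] show ?thesis by simp
  next
    case (2 b t)
    have "\<phi> g = 0" unfolding 2 using 2(1) by (simp add: \<phi>_simps)
    then show ?thesis using deg by simp
  qed
qed

end

lemma (in odd_artin) even_relation_cases:
  assumes a: "a \<in> carrier G" and n: "n > 0"
    and rel: "alt_prod G x a (2 * n) = alt_prod G a x (2 * n)"
  obtains t1 t2 :: int where "a = w [^] t1 \<otimes> x [^] t2"
  | b and t :: int where "b \<in> carrier G" "a = inv x \<otimes> b \<otimes> u [^] t \<otimes> inv b" "N dvd t * int n"
  | b and t :: int where "b \<in> carrier G" "a = inv x \<otimes> b \<otimes> D [^] t \<otimes> inv b" "even n"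
proof -
  have g: "x \<otimes> a \<in> carrier G" using a by simp
  have "x \<otimes> (x \<otimes> a) [^] n = (x \<otimes> a) [^] n \<otimes> x"
    using rel even_relation_iff[OF _ a] by simp
  from commute_pow_cases[OF g n this] show thesis
  proof cases
    case (1 i j)
    from shift_power[OF a _ w_central this] show thesis using that(1) by simp
  next
    case (2 b t)
    then show thesis using that(2)[of b t] shift_conj[OF a 2(1) _ 2(2)] by simp
  next
    case (3 b t)
    then show thesis using that(3)[of b t] shift_conj[OF a 3(1) _ 3(2)] by simp
  qed
qed

lemma artin_group_Artin: "artin_group (Artin m) m"
  by (intro artin_group.intro artin_group_axioms.intro group_Artin) simp

text \<open>Label 2 lies outside \<open>even_artin\<close>; here the relation makes \<open>x\<close>
  commute with \<open>u\<close>, so \<open>x\<close> is central.\<close>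

lemma Artin_2_comm:
  assumes "a \<in> carrier (Artin 2)"
  shows "sgen1 2 \<otimes>\<^bsub>Artin 2\<^esub> a = a \<otimes>\<^bsub>Artin 2\<^esub> sgen1 2"
proof -
  interpret artin_group "Artin 2" 2 by (rule artin_group_Artin)
  have "alt_prod (Artin 2) x y (2 * 1) = alt_prod (Artin 2) y x (2 * 1)"
    by (rule Artin_relation) (simp add: numeral_eq_enat)
  then have xu: "x \<otimes>\<^bsub>Artin 2\<^esub> u = u \<otimes>\<^bsub>Artin 2\<^esub> x"
    unfolding even_relation_iff[OF gens_carrier] by simp
  show ?thesis by (rule centralI[OF gens_carrier(1) HOL.refl xu assms])
qed

theorem theorem2p1:
  fixes mA mB :: enat
  assumes "mA \<ge> 2" and "mB \<ge> 2"
  defines "A \<equiv> Artin mA" and "B \<equiv> Artin mB"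
  shows
  \<comment> \<open>(1)\<close>
  "(mA = \<infinity> \<longrightarrow>
      (\<forall>y\<in>carrier B. \<exists>\<phi>\<in>hom A B. \<phi> (sgen1 mA) = sgen1 mB \<and> \<phi> (sgen2 mA) = y))
   \<and>
   \<comment> \<open>(7)\<close>
   (\<forall>a. mA = enat a \<longrightarrow> even a \<longrightarrow> mB = 2 \<longrightarrow>
      (\<forall>y\<in>carrier B. \<exists>\<phi>\<in>hom A B. \<phi> (sgen1 mA) = sgen1 mB \<and> \<phi> (sgen2 mA) = y))
   \<and>
   (\<forall>\<phi>\<in>hom A B. \<phi> (sgen1 mA) = sgen1 mB \<longrightarrow>
      \<comment> \<open>(2)\<close>
      (\<forall>a. mA = enat a \<longrightarrow> odd a \<longrightarrow> (mB = \<infinity> \<or> (\<exists>b. mB = enat b \<and> even b)) \<longrightarrow>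
         \<phi> (sgen2 mA) = sgen1 mB)
    \<and>
      \<comment> \<open>(3)\<close>
      (\<forall>a b. mA = enat a \<longrightarrow> mB = enat b \<longrightarrow> odd a \<longrightarrow> odd b \<longrightarrow>
         \<phi> (sgen2 mA) = sgen1 mB \<or>
         (b dvd a \<and> (\<exists>t::int. \<phi> (sgen2 mA) =
             sgen1 mB [^]\<^bsub>B\<^esub> t \<otimes>\<^bsub>B\<^esub> sgen2 mB \<otimes>\<^bsub>B\<^esub> sgen1 mB [^]\<^bsub>B\<^esub> (- t))))
    \<and>
      \<comment> \<open>(4)\<close>
      (\<forall>a. mA = enat a \<longrightarrow> even a \<longrightarrow> mB = \<infinity> \<longrightarrow>
         (\<exists>t::int. \<phi> (sgen2 mA) = sgen1 mB [^]\<^bsub>B\<^esub> t))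
    \<and>
      \<comment> \<open>(5)\<close>
      (\<forall>a b. mA = enat a \<longrightarrow> mB = enat b \<longrightarrow> even a \<longrightarrow> odd b \<longrightarrow>
         (\<exists>t1::int. \<exists>t2::int. \<phi> (sgen2 mA) =
             central_delta b [^]\<^bsub>B\<^esub> t1 \<otimes>\<^bsub>B\<^esub> sgen1 mB [^]\<^bsub>B\<^esub> t2)
       \<or> (4 dvd a \<and> (\<exists>\<beta>\<in>carrier B. \<exists>t::int. \<phi> (sgen2 mA) =
             inv\<^bsub>B\<^esub> (sgen1 mB) \<otimes>\<^bsub>B\<^esub> \<beta> \<otimes>\<^bsub>B\<^esub> Garside b [^]\<^bsub>B\<^esub> t
               \<otimes>\<^bsub>B\<^esub> inv\<^bsub>B\<^esub> \<beta>))
       \<or> (\<exists>\<beta>\<in>carrier B. \<exists>t::int. \<phi> (sgen2 mA) =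
             inv\<^bsub>B\<^esub> (sgen1 mB) \<otimes>\<^bsub>B\<^esub> \<beta> \<otimes>\<^bsub>B\<^esub> u_elt mB [^]\<^bsub>B\<^esub> t
               \<otimes>\<^bsub>B\<^esub> inv\<^bsub>B\<^esub> \<beta>
           \<and> (let p = gcd t (int b); q = int b div p in q dvd int a div 2)))
    \<and>
      \<comment> \<open>(6)\<close>
      (\<forall>a b. mA = enat a \<longrightarrow> mB = enat b \<longrightarrow> even a \<longrightarrow> even b \<longrightarrow> b \<noteq> 2 \<longrightarrow>
         (\<exists>t1::int. \<exists>t2::int. \<phi> (sgen2 mA) =
             central_delta b [^]\<^bsub>B\<^esub> t1 \<otimes>\<^bsub>B\<^esub> sgen1 mB [^]\<^bsub>B\<^esub> t2)
       \<or> (\<exists>\<beta>\<in>carrier B. \<exists>t::int. \<phi> (sgen2 mA) =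
             inv\<^bsub>B\<^esub> (sgen1 mB) \<otimes>\<^bsub>B\<^esub> \<beta> \<otimes>\<^bsub>B\<^esub> u_elt mB [^]\<^bsub>B\<^esub> t
               \<otimes>\<^bsub>B\<^esub> inv\<^bsub>B\<^esub> \<beta>
           \<and> (let p = gcd t (int b div 2); q = int b div (2 * p) in q dvd int a div 2))))"
proof -
  interpret A: group A unfolding A_def by (rule group_Artin)
  interpret B: artin_group B mB unfolding B_def by (rule artin_group_Artin)
  have extend: "\<exists>\<phi>\<in>hom A B. \<phi> (sgen1 mA) = sgen1 mB \<and> \<phi> (sgen2 mA) = y"
    if "y \<in> carrier B" "\<And>n. mA = enat n \<Longrightarrow> alt_prod B (sgen1 mB) y n = alt_prod B y (sgen1 mB) n" for y
    using Artin_universal[OF B.is_group B.gens_carrier(1) that] unfolding A_def by metis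
  have 1: "\<exists>\<phi>\<in>hom A B. \<phi> (sgen1 mA) = sgen1 mB \<and> \<phi> (sgen2 mA) = y"
    if "mA = \<infinity>" "y \<in> carrier B" for y
    using that by (intro extend) simp_all
  have 7: "\<exists>\<phi>\<in>hom A B. \<phi> (sgen1 mA) = sgen1 mB \<and> \<phi> (sgen2 mA) = y"
    if "mA = enat a" "even a" "mB = 2" "y \<in> carrier B" for a y
  proof (rule extend[OF that(4)])
    fix n assume "mA = enat n"
    with that(1,2) have "even n" by simp
    then obtain k where k: "n = 2 * k" ..
    have "sgen1 mB \<otimes>\<^bsub>B\<^esub> y = y \<otimes>\<^bsub>B\<^esub> sgen1 mB"
      using Artin_2_comm that unfolding B_def by simp
    then have "(sgen1 mB \<otimes>\<^bsub>B\<^esub> y) \<otimes>\<^bsub>B\<^esub> sgen1 mB = sgen1 mB \<otimes>\<^bsub>B\<^esub> (sgen1 mB \<otimes>\<^bsub>B\<^esub> y)"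
      by (metis B.m_assoc B.gens_carrier(1) that(4))
    then show "alt_prod B (sgen1 mB) y n = alt_prod B y (sgen1 mB) n"
      unfolding k B.even_relation_iff[OF B.gens_carrier(1) that(4)]
      using that(4) by (intro B.group_commutes_pow[symmetric]) simp_all
  qed
  \<comment> \<open>The lower bound 2 on the label excludes \<open>n = 0\<close>.\<close>
  have half: "\<exists>n>0. a = 2 * n" if "mA = enat a" "even a" for a
    using that assms(1) by (auto simp: numeral_eq_enat elim!: evenE)
  have rel: "alt_prod B (sgen1 mB) (\<phi> (sgen2 mA)) a = alt_prod B (\<phi> (sgen2 mA)) (sgen1 mB) a"
    if "\<phi> \<in> hom A B" "\<phi> (sgen1 mA) = sgen1 mB" "mA = enat a" for \<phi> a
    using hom_alt_prod[OF that(1) A.is_group B.is_group] Artin_relation[OF that(3)] that(2)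
    unfolding A_def by (metis sgen_carrier)
  have closed: "\<phi> (sgen2 mA) \<in> carrier B" if "\<phi> \<in> hom A B" for \<phi>
    using hom_in_carrier[OF that] unfolding A_def by simp
  have even: "even_artin B mB k" if "k \<noteq> 1" "mB = (if k = 0 then \<infinity> else enat (2 * k))" for k
    using that by (intro even_artin.intro even_artin_axioms.intro B.artin_group_axioms)
  have odd: "odd_artin B mB h" if "mB = enat (Suc (2 * h))" for h
    using that assms(2)
    by (intro odd_artin.intro odd_artin_axioms.intro B.artin_group_axioms)
      (auto simp: numeral_eq_enat)
  have u: "u_elt mB = sgen1 mB \<otimes>\<^bsub>B\<^esub> sgen2 mB"
    by (simp add: u_elt_def B_def)
  have 2: "\<phi> (sgen2 mA) = sgen1 mB"
    if \<phi>: "\<phi> \<in> hom A B" "\<phi> (sgen1 mA) = sgen1 mB" and a: "mA = enat a" "odd a"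
      and b: "mB = \<infinity> \<or> (\<exists>b. mB = enat b \<and> even b)" for \<phi> a
  proof -
    from a(2) obtain n where n: "a = Suc (2 * n)" by (auto elim: oddE)
    note rel = rel[OF \<phi> a(1), unfolded n]
    \<comment> \<open>Label 2 is outside \<open>even_artin\<close>; there commutation alone
      collapses the relation.\<close>
    show ?thesis
    proof (cases "mB = 2")
      case True
      have comm: "sgen1 mB \<otimes>\<^bsub>B\<^esub> \<phi> (sgen2 mA) = \<phi> (sgen2 mA) \<otimes>\<^bsub>B\<^esub> sgen1 mB"
        using Artin_2_comm closed[OF \<phi>(1)] True unfolding B_def by simp
      note rel' = rel[unfolded B.odd_relation_iff[OF B.gens_carrier(1) closed[OF \<phi>(1)]]]
      show ?thesis
        by (rule B.commute_relation_eq[OF B.gens_carrier(1) closed[OF \<phi>(1)] comm rel'])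
    next
      case False
      obtain k where k: "k \<noteq> 1" "mB = (if k = 0 then \<infinity> else enat (2 * k))"
      proof (cases "mB = \<infinity>")
        case True
        then show ?thesis using that[of 0] by simp
      next
        case fin: False
        then obtain k where "mB = enat (2 * k)" using b by (auto elim!: evenE)
        then show ?thesis using that[of k] False assms(2) by (auto simp: numeral_eq_enat)
      qed
      interpret even_artin B mB k using k by (rule even)
      show ?thesis using odd_relation_eq[OF closed[OF \<phi>(1)] rel] .
    qed
  qed
  have 3: "\<phi> (sgen2 mA) = sgen1 mB \<or>
         (b dvd a \<and> (\<exists>t::int. \<phi> (sgen2 mA) =
             sgen1 mB [^]\<^bsub>B\<^esub> t \<otimes>\<^bsub>B\<^esub> sgen2 mB \<otimes>\<^bsub>B\<^esub> sgen1 mB [^]\<^bsub>B\<^esub> (- t)))"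
    if \<phi>: "\<phi> \<in> hom A B" "\<phi> (sgen1 mA) = sgen1 mB" and ab: "mA = enat a" "mB = enat b" "odd a" "odd b"
    for \<phi> a b
  proof -
    from ab obtain n h where n: "a = Suc (2 * n)" and bh: "b = Suc (2 * h)" by (auto elim!: oddE)
    interpret odd_artin B mB h using ab bh by (intro odd) simp
    show ?thesis
      unfolding n bh
      using rel[OF \<phi> ab(1), unfolded n] B.odd_relation_iff[OF B.gens_carrier(1) closed[OF \<phi>(1)], of n]
      by (intro odd_relation_cases closed \<phi>) simp
  qed
  have 4: "\<exists>t::int. \<phi> (sgen2 mA) = sgen1 mB [^]\<^bsub>B\<^esub> t"
    if \<phi>: "\<phi> \<in> hom A B" "\<phi> (sgen1 mA) = sgen1 mB" and a: "mA = enat a" "even a" "mB = \<infinity>" for \<phi> a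
  proof -
    obtain n where n: "n > 0" "a = 2 * n" using half[OF a(1,2)] by blast
    interpret even_artin B mB 0 using a by (intro even) simp_all
    from even_relation_cases[OF closed[OF \<phi>(1)] n(1) rel[OF \<phi> a(1), unfolded n(2)]] show ?thesis
    proof cases
      case (1 t1 t2)
      then show ?thesis by auto
    next
      case (2 b t)
      \<comment> \<open>With \<open>k = 0\<close> the divisibility reads
        \<open>0 dvd t * int n\<close>.\<close>
      then have "t = 0" using n by simp
      then have "\<phi> (sgen2 mA) = sgen1 mB [^]\<^bsub>B\<^esub> (- 1 :: int)"
        using 2 by (simp add: B.m_assoc B.int_pow_neg)
      then show ?thesis ..
    qed
  qed
  have 5: "(\<exists>t1::int. \<exists>t2::int. \<phi> (sgen2 mA) =
             central_delta b [^]\<^bsub>B\<^esub> t1 \<otimes>\<^bsub>B\<^esub> sgen1 mB [^]\<^bsub>B\<^esub> t2)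
       \<or> (4 dvd a \<and> (\<exists>\<beta>\<in>carrier B. \<exists>t::int. \<phi> (sgen2 mA) =
             inv\<^bsub>B\<^esub> (sgen1 mB) \<otimes>\<^bsub>B\<^esub> \<beta> \<otimes>\<^bsub>B\<^esub> Garside b [^]\<^bsub>B\<^esub> t
               \<otimes>\<^bsub>B\<^esub> inv\<^bsub>B\<^esub> \<beta>))
       \<or> (\<exists>\<beta>\<in>carrier B. \<exists>t::int. \<phi> (sgen2 mA) =
             inv\<^bsub>B\<^esub> (sgen1 mB) \<otimes>\<^bsub>B\<^esub> \<beta> \<otimes>\<^bsub>B\<^esub> u_elt mB [^]\<^bsub>B\<^esub> t
               \<otimes>\<^bsub>B\<^esub> inv\<^bsub>B\<^esub> \<beta>
           \<and> (let p = gcd t (int b); q = int b div p in q dvd int a div 2))"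
    if \<phi>: "\<phi> \<in> hom A B" "\<phi> (sgen1 mA) = sgen1 mB" and ab: "mA = enat a" "mB = enat b" "even a" "odd b"
    for \<phi> a b
  proof -
    obtain n where n: "n > 0" "a = 2 * n" using half[OF ab(1,3)] by blast
    from ab obtain h where bh: "b = Suc (2 * h)" by (auto elim!: oddE)
    interpret odd_artin B mB h using ab bh by (intro odd) simp
    have D: "Garside b = D"
      unfolding Garside_alt_prod D_alt_prod using ab bh by (simp add: B_def)
    have w: "central_delta b = w"
      using D ab by (simp add: central_delta_def B_def)
    from even_relation_cases[OF closed[OF \<phi>(1)] n(1) rel[OF \<phi> ab(1), unfolded n(2)]] show ?thesis
    proof cases
      case (1 t1 t2)
      then show ?thesis unfolding w by (intro disjI1 exI)
    next
      case (2 \<beta> t)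
      have "int b dvd t * int n" using 2(3) bh by simp
      then have "int b div gcd t (int b) dvd int n"
        using div_gcd_dvd[of "int b" t "int n"] bh by simp
      then have q: "let p = gcd t (int b); q = int b div p in q dvd int a div 2"
        using n by (simp add: Let_def)
      show ?thesis
        unfolding u by (intro disjI2 bexI[of _ \<beta>] exI[of _ t] conjI) (fact 2(1,2) q)+
    next
      case (3 \<beta> t)
      have "4 dvd a" using 3(3) n by auto
      show ?thesis
        unfolding D by (rule disjI2, rule disjI1, intro bexI[of _ \<beta>] exI[of _ t] conjI)
          (fact 3(1,2) \<open>4 dvd a\<close>)+
    qed
  qed
  have 6: "(\<exists>t1::int. \<exists>t2::int. \<phi> (sgen2 mA) =
             central_delta b [^]\<^bsub>B\<^esub> t1 \<otimes>\<^bsub>B\<^esub> sgen1 mB [^]\<^bsub>B\<^esub> t2)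
       \<or> (\<exists>\<beta>\<in>carrier B. \<exists>t::int. \<phi> (sgen2 mA) =
             inv\<^bsub>B\<^esub> (sgen1 mB) \<otimes>\<^bsub>B\<^esub> \<beta> \<otimes>\<^bsub>B\<^esub> u_elt mB [^]\<^bsub>B\<^esub> t
               \<otimes>\<^bsub>B\<^esub> inv\<^bsub>B\<^esub> \<beta>
           \<and> (let p = gcd t (int b div 2); q = int b div (2 * p) in q dvd int a div 2))"
    if \<phi>: "\<phi> \<in> hom A B" "\<phi> (sgen1 mA) = sgen1 mB"
      and ab: "mA = enat a" "mB = enat b" "even a" "even b" "b \<noteq> 2"
    for \<phi> a b
  proof -
    obtain n where n: "n > 0" "a = 2 * n" using half[OF ab(1,3)] by blast
    from ab obtain k where bk: "b = 2 * k" by (auto elim!: evenE)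
    \<comment> \<open>The bound on the label keeps \<open>k\<close> away from 0, which would encode
      the infinite label.\<close>
    have k_pos: "k > 0" using bk ab(2) assms(2) by (auto simp: numeral_eq_enat)
    interpret even_artin B mB k using ab bk k_pos by (intro even) simp_all
    have w: "central_delta b = w"
      using ab bk B.alt_prod_even[OF B.gens_carrier, of k]
      by (simp add: central_delta_def Garside_alt_prod B_def int_pow_int)
    from even_relation_cases[OF closed[OF \<phi>(1)] n(1) rel[OF \<phi> ab(1), unfolded n(2)]] show ?thesis
    proof cases
      case (1 t1 t2)
      then show ?thesis unfolding w by (intro disjI1 exI)
    next
      case (2 \<beta> t)
      have "int k div gcd t (int k) dvd int n"
        using div_gcd_dvd[of "int k" t "int n"] 2(3) k_pos by simp
      then have q: "let p = gcd t (int b div 2); q = int b div (2 * p) in q dvd int a div 2"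
        using n bk by (simp add: Let_def)
      show ?thesis
        unfolding u by (intro disjI2 bexI[of _ \<beta>] exI[of _ t] conjI) (fact 2(1,2) q)+
    qed
  qed
  show ?thesis
    by (intro conjI ballI allI impI) (rule 1 7 2 3 4 5 6; assumption)+
qed

end
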